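(* Let $\vec{G}$ be an oriented graph. If $\vec{G}$ is not $2$-mixing, then $\mathrm{Mad}(\vec{G})\ge \frac72$.
   Context: An oriented graph is a digraph with no pair of opposite arcs $uv,vu$. A $2$-dicolouring is a map $V\to\{1,2\}$ with no monochromatic directed cycle; $\vec{G}$ is $2$-mixing if the graph on its $2$-dicolourings, two adjacent when they differ on exactly one vertex, is connected. $\mathrm{Mad}(\vec{G})=\max\{2|A(H)|/|V(H)| : H \text{ non-empty subdigraph of } \vec{G}\}$. *)

theory Defs
  imports Complex_Main "HOL-Library.FuncSet" "Graph_Theory.Graph_Theory"
begin

text \<open>
  The locale \<^locale>\<open>digraph\<close> provides finiteness and excludes loops and parallel arcs;
  the null digraph is allowed.
\<close>

locale oriented_graph = digraph +
  assumes no_opposite_arcs: "(u, v) \<in> arcs_ends G \<Longrightarrow> (v, u) \<notin> arcs_ends G"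

text \<open>
  Colourings are extensional, so that each map from the vertex set to the colours is represented
  by exactly one HOL function. The vertices of a cycle are the tails of its arcs.
\<close>

definition dicolouring :: "('a, 'b) pre_digraph \<Rightarrow> nat \<Rightarrow> ('a \<Rightarrow> nat) \<Rightarrow> bool" where
  "dicolouring G k c \<longleftrightarrow>
     c \<in> PiE (verts G) (\<lambda>_. {1..k}) \<and>
     \<not> (\<exists>p i. pre_digraph.cycle G p \<and> (\<forall>e \<in> set p. c (tail G e) = i))"

text \<open>
  Each undirected edge of the graph of dicolourings is represented by two opposite arcs.
\<close>

definition dicolouring_graph :: "('a, 'b) pre_digraph \<Rightarrow> nat \<Rightarrow> ('a \<Rightarrow> nat) pair_pre_digraph" where
  "dicolouring_graph G k =
     \<lparr> pverts = {c. dicolouring G k c},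
       parcs = {(c, c'). dicolouring G k c \<and> dicolouring G k c' \<and>
                         card {v \<in> verts G. c v \<noteq> c' v} = 1} \<rparr>"

text \<open>
  The qualified name avoids the topological notion of connectedness. A graph without vertices is
  not connected, so a digraph without any \<open>k\<close>-dicolouring is not \<open>k\<close>-mixing.
\<close>

definition mixing :: "nat \<Rightarrow> ('a, 'b) pre_digraph \<Rightarrow> bool" where
  "mixing k G \<longleftrightarrow> Digraph_Component.connected (with_proj (dicolouring_graph G k))"

text \<open>
  For a finite digraph with at least one vertex the set below is finite and non-empty; for the
  null digraph the value is unspecified.
\<close>

definition Mad :: "('a, 'b) pre_digraph \<Rightarrow> real" where
  "Mad G = Max {2 * real (card (arcs H)) / real (card (verts H)) | H.
                  subgraph H G \<and> verts H \<noteq> {}}"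

end

theory Submission
  imports Defs
begin

text \<open>
  Take a vertex-minimal non-mixing induced subdigraph that has a 2-dicolouring (without one, all
  in-degrees are at least 2). Its minimum degree is 3, and a vertex \<open>z\<close> of degree 3 has a unique
  in-neighbour or a unique out-neighbour, its supporter. If \<open>z\<close> has the colour opposite to its
  supporter, then it lies on no monochromatic cycle, so every dicolouring can be moved to one where
  all degree-3 vertices have this canonical colour, and \<open>z\<close> only matters while its supporter is
  being recoloured. Deleting a vertex and lifting recolouring sequences of the smaller digraph
  then yields: supporters have degree at least 4; all other neighbours of \<open>z\<close> have degree at
  least 4 or share its supporter; and a vertex of degree at least 4 with at most one neighbour of
  degree at least 4 has several degree-3 neighbours with one common supporter. Discharging turns
  this into an average degree of at least \<open>7/2\<close>.
\<close>

section \<open>Recolouring\<close>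

definition mono_arcs :: "'a rel \<Rightarrow> 'a set \<Rightarrow> ('a \<Rightarrow> 'c) \<Rightarrow> 'a rel" where
  "mono_arcs E A c = {(x, y). (x, y) \<in> E \<and> x \<in> A \<and> y \<in> A \<and> c x = c y}"

definition good :: "'a rel \<Rightarrow> 'a set \<Rightarrow> ('a \<Rightarrow> bool) \<Rightarrow> bool" where
  "good E A c \<longleftrightarrow> acyclic (mono_arcs E A c)"

text \<open>Colours outside \<open>A\<close> are irrelevant, so \<open>c\<close> and \<open>c'\<close> may differ arbitrarily there.\<close>

definition adj :: "'a rel \<Rightarrow> 'a set \<Rightarrow> ('a \<Rightarrow> bool) \<Rightarrow> ('a \<Rightarrow> bool) \<Rightarrow> bool" where
  "adj E A c c' \<longleftrightarrow> good E A c \<and> good E A c' \<and> (\<exists>x. \<forall>y\<in>A. y \<noteq> x \<longrightarrow> c y = c' y)"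

abbreviation linked :: "'a rel \<Rightarrow> 'a set \<Rightarrow> ('a \<Rightarrow> bool) \<Rightarrow> ('a \<Rightarrow> bool) \<Rightarrow> bool" where
  "linked E A \<equiv> (adj E A)\<^sup>*\<^sup>*"

definition mix :: "'a rel \<Rightarrow> 'a set \<Rightarrow> bool" where
  "mix E A \<longleftrightarrow> (\<exists>c. good E A c) \<and> (\<forall>c c'. good E A c \<longrightarrow> good E A c' \<longrightarrow> linked E A c c')"

lemma good_cong_subset:
  assumes "good E A c" "B \<subseteq> A" "\<And>v. v \<in> B \<Longrightarrow> c' v = c v"
  shows "good E B c'"
proof -
  have "mono_arcs E B c' \<subseteq> mono_arcs E A c"
    using assms(2,3) by (auto simp: mono_arcs_def)
  then show ?thesis
    using assms(1) acyclic_subset unfolding good_def by blast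
qed

text \<open>A vertex without a monochromatic in-arc, or without a monochromatic out-arc, lies on no
  monochromatic cycle. Such a cycle in \<open>A\<close> therefore avoids \<open>D\<close> and
  already lies in \<open>A - D\<close>.\<close>

lemma good_remove:
  assumes "good E (A - D) c"
    and dead: "\<And>z. z \<in> D \<Longrightarrow> z \<in> A \<Longrightarrow>
      (\<forall>y\<in>A. (y, z) \<in> E \<longrightarrow> c y \<noteq> c z) \<or> (\<forall>y\<in>A. (z, y) \<in> E \<longrightarrow> c y \<noteq> c z)"
  shows "good E A c"
  unfolding good_def acyclic_def
proof (intro allI notI)
  fix x
  let ?M = "mono_arcs E A c" and ?N = "mono_arcs E (A - D) c"
  assume cyc: "(x, x) \<in> ?M\<^sup>+"
  have alive: "y \<notin> D" if "(x, y) \<in> ?M\<^sup>*" "(y, x) \<in> ?M\<^sup>*" for y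
  proof
    assume "y \<in> D"
    have "(y, y) \<in> ?M\<^sup>+"
      using that cyc by (meson rtrancl_trancl_trancl trancl_rtrancl_trancl)
    then obtain p q where "(p, y) \<in> ?M" "(y, q) \<in> ?M"
      by (meson tranclD tranclD2)
    then show False
      using dead[OF \<open>y \<in> D\<close>] by (auto simp: mono_arcs_def)
  qed
  have "(x, y) \<in> ?N\<^sup>+" if "(x, y) \<in> ?M\<^sup>+" "(y, x) \<in> ?M\<^sup>*" for y
    using that
  proof (induction rule: trancl_induct)
    case (base y)
    then have "x \<notin> D" "y \<notin> D"
      using alive[of x] alive[of y] cyc by auto
    then show ?case
      using base by (auto simp: mono_arcs_def)
  next
    case (step y z)
    have yx: "(y, x) \<in> ?M\<^sup>*"
      using step.hyps(2) step.prems by (rule converse_rtrancl_into_rtrancl)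
    have "(x, y) \<in> ?M\<^sup>*" "(x, z) \<in> ?M\<^sup>*"
      using step.hyps by (simp_all add: trancl_into_rtrancl rtrancl_into_rtrancl)
    then have "y \<notin> D" "z \<notin> D"
      using alive yx step.prems by blast+
    then have "(y, z) \<in> ?N"
      using step.hyps by (auto simp: mono_arcs_def)
    then show ?case
      by (rule trancl_into_trancl[OF step.IH[OF yx]])
  qed
  then have "(x, x) \<in> ?N\<^sup>+"
    using cyc by simp
  then show False
    using assms(1) by (auto simp: good_def acyclic_def)
qed

lemma good_converse: "good (E\<inverse>) A c = good E A c"
proof -
  have "mono_arcs (E\<inverse>) A c = (mono_arcs E A c)\<inverse>"
    by (auto simp: mono_arcs_def)
  then show ?thesis
    by (simp add: good_def)
qed

text \<open>Reversing all arcs turns directed cycles into directed cycles. Results about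
  in-neighbours thus carry over to out-neighbours.\<close>

lemma mix_converse: "mix (E\<inverse>) A = mix E A"
proof -
  have "adj (E\<inverse>) A = adj E A"
    by (intro ext) (simp add: adj_def good_converse)
  then show ?thesis
    by (simp add: mix_def good_converse)
qed

lemma linked_sym: "linked E A c c' \<Longrightarrow> linked E A c' c"
proof (rule sympD[OF symp_rtranclp])
  show "symp (adj E A)"
    by (auto simp: symp_def adj_def)
qed

lemma adj_agree:
  assumes "good E A c" "\<And>v. v \<in> A \<Longrightarrow> c v = c' v"
  shows "linked E A c c'"
proof -
  have "good E A c'"
    using good_cong_subset[OF assms(1) subset_refl, of c'] assms(2) by simp
  then have "adj E A c c'"
    using assms by (auto simp: adj_def)
  then show ?thesis by blast
qed

lemma adj_flip:
  assumes "good E A c" "good E A c'" "\<And>v. v \<in> A \<Longrightarrow> v \<noteq> x \<Longrightarrow> c v = c' v"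
  shows "linked E A c c'"
  using assms by (intro r_into_rtranclp) (auto simp: adj_def)

section \<open>Supported vertices and their canonical colours\<close>

definition supported :: "'a rel \<Rightarrow> 'a set \<Rightarrow> 'a set \<Rightarrow> ('a \<Rightarrow> 'a) \<Rightarrow> bool" where
  "supported E A S sp \<longleftrightarrow> finite S \<and> S \<subseteq> A \<and> (\<forall>z\<in>S. sp z \<in> A - S \<and>
     ((\<forall>y\<in>A. (y, z) \<in> E \<longrightarrow> y = sp z) \<or> (\<forall>y\<in>A. (z, y) \<in> E \<longrightarrow> y = sp z)))"

lemma supported_converse: "supported (E\<inverse>) A S sp = supported E A S sp"
  unfolding supported_def by auto

definition canon :: "'a set \<Rightarrow> ('a \<Rightarrow> 'a) \<Rightarrow> ('a \<Rightarrow> bool) \<Rightarrow> 'a \<Rightarrow> bool" where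
  "canon S sp c v = (if v \<in> S then \<not> c (sp v) else c v)"

lemma good_supported:
  assumes sp: "supported E A S sp" and "D \<subseteq> S" "good E (A - D) c"
    and "\<And>z. z \<in> D \<Longrightarrow> c z \<noteq> c (sp z)"
  shows "good E A c"
proof (rule good_remove[OF assms(3)])
  fix z assume z: "z \<in> D" "z \<in> A"
  then have "(\<forall>y\<in>A. (y, z) \<in> E \<longrightarrow> y = sp z) \<or> (\<forall>y\<in>A. (z, y) \<in> E \<longrightarrow> y = sp z)"
    using sp \<open>D \<subseteq> S\<close> unfolding supported_def by blast
  then show "(\<forall>y\<in>A. (y, z) \<in> E \<longrightarrow> c y \<noteq> c z) \<or> (\<forall>y\<in>A. (z, y) \<in> E \<longrightarrow> c y \<noteq> c z)"
    using assms(4)[OF z(1)] by auto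
qed

text \<open>A vertex coloured unlike its supporter has no monochromatic arc on one side, whatever
  its other neighbours do. Supporters lie outside \<open>S\<close>, so all of \<open>D\<close> can
  be coloured this way at once without creating a cycle.\<close>

lemma good_canon:
  assumes "supported E A S sp" "D \<subseteq> S" "good E (A - D) c"
  shows "good E A (canon D sp c)"
proof (rule good_supported[OF assms(1,2)])
  show "good E (A - D) (canon D sp c)"
    using good_cong_subset[OF assms(3) subset_refl] by (simp add: canon_def)
  show "canon D sp c z \<noteq> canon D sp c (sp z)" if "z \<in> D" for z
  proof -
    have "sp z \<notin> D"
      using assms that by (auto simp: supported_def)
    then show ?thesis
      using that by (simp add: canon_def)
  qed
qed

text \<open>The vertices of \<open>S\<close> switch to their canonical colours one at a time. Each
  intermediate colouring is canonical on some part \<open>D\<close> of \<open>S\<close>, hence good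
  by \<open>good_canon\<close>.\<close>

lemma linked_canon:
  assumes sp: "supported E A S sp" and "good E A c"
  shows "linked E A c (canon S sp c)"
proof -
  have good: "good E A (canon D sp c)" if "D \<subseteq> S" for D
    using good_canon[OF sp that] good_cong_subset[OF assms(2) Diff_subset] by simp
  have "linked E A c (canon D sp c)" if "finite D" "D \<subseteq> S" for D
    using that
  proof (induction D)
    case empty
    then show ?case
      using assms by (intro adj_agree) (auto simp: canon_def)
  next
    case (insert z D)
    have "linked E A (canon D sp c) (canon (insert z D) sp c)"
      using insert by (intro adj_flip[where x=z] good) (auto simp: canon_def)
    then show ?case
      using insert by auto
  qed
  then show ?thesis
    using sp by (auto simp: supported_def)
qed

text \<open>Canonical colours forget what happens on \<open>S\<close>, so \<open>c\<close> and
  \<open>c'\<close> can be exchanged for representatives \<open>L\<close> and \<open>L'\<close>. The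
  route leaves the canonical colouring, recolours \<open>x\<close> between \<open>L\<close> and
  \<open>L'\<close>, and becomes canonical again.\<close>

lemma linked_canon_flip:
  assumes sp: "supported E A S sp"
    and L: "good E A L" "good E A L'" "\<And>v. v \<in> A \<Longrightarrow> v \<noteq> x \<Longrightarrow> L v = L' v"
    and c: "\<And>v. v \<in> A - S \<Longrightarrow> c v = L v" "\<And>v. v \<in> A - S \<Longrightarrow> c' v = L' v"
  shows "linked E A (canon S sp c) (canon S sp c')"
proof -
  have agree: "linked E A (canon S sp c) (canon S sp L)"
    if "good E A L" "\<And>v. v \<in> A - S \<Longrightarrow> c v = L v" for c L
  proof (rule linked_sym, rule adj_agree)
    show "good E A (canon S sp L)"
      using good_canon[OF sp subset_refl] good_cong_subset[OF that(1) Diff_subset] by simp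
    show "canon S sp L v = canon S sp c v" if "v \<in> A" for v
    proof (cases "v \<in> S")
      case True
      then have "sp v \<in> A - S"
        using sp by (auto simp: supported_def)
      with True show ?thesis
        using \<open>\<And>v. v \<in> A - S \<Longrightarrow> c v = L v\<close> by (simp add: canon_def)
    next
      case False
      then show ?thesis
        using that \<open>\<And>v. v \<in> A - S \<Longrightarrow> c v = L v\<close> by (simp add: canon_def)
    qed
  qed
  have "linked E A (canon S sp c) (canon S sp L)"
    using agree[OF L(1) c(1)] .
  also have "linked E A \<dots> L"
    by (rule linked_sym[OF linked_canon[OF sp L(1)]])
  also have "linked E A \<dots> L'"
    using L by (rule adj_flip)
  also have "linked E A \<dots> (canon S sp L')"
    by (rule linked_canon[OF sp L(2)])
  also have "linked E A \<dots> (canon S sp c')"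
    by (rule linked_sym[OF agree[OF L(2) c(2)]])
  finally show ?thesis .
qed

section \<open>Lifting recolouring sequences\<close>

text \<open>
  The vertices that can lie on a monochromatic cycle if every vertex of \<open>S\<close> not supported by \<open>x\<close>
  has its canonical colour.
\<close>

definition alive :: "'a set \<Rightarrow> 'a set \<Rightarrow> ('a \<Rightarrow> 'a) \<Rightarrow> 'a \<Rightarrow> 'a set" where
  "alive A S sp x = A - {v \<in> S. sp v \<noteq> x}"

text \<open>Recolouring \<open>x\<close> affects only the canonical colours of vertices supported by
  \<open>x\<close>. All other vertices of \<open>S\<close> can stay canonical during the step and
  lie on no monochromatic cycle, so goodness has to be checked on \<open>alive A S sp x\<close>
  alone.\<close>

lemma linked_canon_alive:
  assumes sp: "supported E A S sp"
    and d: "good E (alive A S sp x) d" "good E (alive A S sp x) d'"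
      "\<And>v. v \<in> alive A S sp x \<Longrightarrow> v \<noteq> x \<Longrightarrow> d v = d' v"
    and c: "\<And>v. v \<in> A - S \<Longrightarrow> c v = d v" "\<And>v. v \<in> A - S \<Longrightarrow> c' v = d' v"
  shows "linked E A (canon S sp c) (canon S sp c')"
proof (rule linked_canon_flip[OF sp])
  let ?D = "{v \<in> S. sp v \<noteq> x}"
  show "good E A (canon ?D sp d)" "good E A (canon ?D sp d')"
    using d good_canon[OF sp, of ?D] by (auto simp: alive_def)
  show "canon ?D sp d v = canon ?D sp d' v" if "v \<in> A" "v \<noteq> x" for v
  proof (cases "v \<in> ?D")
    case True
    then have "sp v \<in> A - S" "sp v \<noteq> x"
      using sp by (auto simp: supported_def)
    then have "d (sp v) = d' (sp v)"
      using d(3) by (auto simp: alive_def)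
    then show ?thesis
      using True by (simp add: canon_def)
  next
    case False
    then have "d v = d' v"
      using d(3) that by (auto simp: alive_def)
    then show ?thesis
      using False by (auto simp: canon_def)
  qed
  show "c v = canon ?D sp d v" "c' v = canon ?D sp d' v" if "v \<in> A - S" for v
    using c that by (auto simp: canon_def)
qed

text \<open>A recolouring sequence on \<open>B\<close> is replayed on \<open>A\<close> through
  canonical colourings, one step at a time; \<open>linked_canon\<close> attaches the given
  colourings at both ends.\<close>

lemma mix_lift:
  assumes sp: "supported E A S sp" and "B \<subseteq> A" "mix E B" "\<exists>c. good E A c"
    and step: "\<And>c c'. adj E B c c' \<Longrightarrow> linked E A (canon S sp c) (canon S sp c')"
  shows "mix E A"
  unfolding mix_def
proof (intro conjI allI impI)
  fix \<alpha> \<beta>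
  assume good: "good E A \<alpha>" "good E A \<beta>"
  then have "linked E B \<alpha> \<beta>"
    using assms(2,3) by (auto simp: mix_def intro: good_cong_subset)
  then have "linked E A (canon S sp \<alpha>) (canon S sp \<beta>)"
  proof (induction rule: rtranclp_induct)
    case (step c c')
    then show ?case
      using assms(5) by (meson rtranclp_trans)
  qed simp
  then show "linked E A \<alpha> \<beta>"
    using linked_canon[OF sp good(1)] linked_sym[OF linked_canon[OF sp good(2)]]
    by (meson rtranclp_trans)
qed (use assms in blast)

section \<open>Deletions under which mixing lifts back\<close>

lemma mix_delete_source:
  assumes "mix E (A - {v})" "\<And>y. y \<in> A \<Longrightarrow> (y, v) \<notin> E"
  shows "mix E A"
proof (rule mix_lift[where S="{}" and sp=id and B="A - {v}"])
  have good: "good E A c" if "good E (A - {v}) c" for c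
    using good_remove[OF that] assms(2) by blast
  show "\<exists>c. good E A c"
    using assms(1) good by (auto simp: mix_def)
  fix c c'
  assume adj: "adj E (A - {v}) c c'"
  then obtain x where x: "\<And>y. y \<in> A - {v} \<Longrightarrow> y \<noteq> x \<Longrightarrow> c y = c' y"
    by (auto simp: adj_def)
  have g: "good E A c" "good E A c'"
    using adj good by (auto simp: adj_def)
  have "good E A (c(v := c' v))"
    using adj good_cong_subset[of E "A - {v}" c "A - {v}"] good by (simp add: adj_def)
  then have "linked E A c (c(v := c' v))" "linked E A (c(v := c' v)) c'"
    using g x adj_flip[of E A c "c(v := c' v)" v] adj_flip[of E A "c(v := c' v)" c' x] by auto
  then have "linked E A c c'"
    by (rule rtranclp_trans)
  then show "linked E A (canon {} id c) (canon {} id c')"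
    by (simp add: canon_def[abs_def])
qed (use assms in \<open>auto simp: supported_def\<close>)

text \<open>
  The deleted vertex \<open>z\<close> never obstructs a recolouring of its supporter: either some colour makes
  \<open>z\<close> a sink among the vertices that matter, or its supporter has only one relevant in-neighbour
  and \<open>z\<close> takes the colour opposite to that in-neighbour.
\<close>

lemma mix_delete_supported:
  assumes sp: "supported E A S sp" and "asym E" and z: "z \<in> S"
    and inz': "\<forall>y\<in>A. (y, z) \<in> E \<longrightarrow> y = sp z" "(sp z, z) \<in> E"
    and f: "(\<forall>y\<in>alive A S sp (sp z). (z, y) \<in> E \<longrightarrow> y = f) \<or>
      (\<forall>y\<in>alive A S sp (sp z). (y, sp z) \<in> E \<longrightarrow> y = f)"
    and "mix E (A - {z})" "\<exists>c. good E A c"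
  shows "mix E A"
proof (rule mix_lift[OF sp _ assms(7,8)])
  note inz = inz'(1)[rule_format] inz'(2)
  let ?x = "sp z" and ?B = "A - {z}"
  have x: "?x \<in> A - S"
    using sp z by (auto simp: supported_def)
  have asym: "(b, a) \<notin> E" if "(a, b) \<in> E" for a b
    using \<open>asym E\<close> that by (auto dest: asymD)
  fix c c'
  assume adj: "adj E ?B c c'"
  then obtain x where agree: "\<And>y. y \<in> ?B \<Longrightarrow> y \<noteq> x \<Longrightarrow> c y = c' y"
    by (auto simp: adj_def)
  show "linked E A (canon S sp c) (canon S sp c')"
  proof (cases "x = ?x")
    case False
    then have "alive A S sp x \<subseteq> ?B"
      using z by (auto simp: alive_def)
    then show ?thesis
      using adj agree by (intro linked_canon_alive[OF sp, of x c c'])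
        (auto simp: adj_def intro: good_cong_subset)
  next
    case True
    \<comment> \<open>The colour \<open>?k\<close> is opposite to that of \<open>f\<close>, which
      the step leaves unchanged whenever \<open>f\<close> matters; one choice for \<open>z\<close>
      therefore serves both before and after the step.\<close>
    let ?L = "alive A S sp ?x" and ?k = "\<not> c f"
    have good: "good E ?L (d(z := ?k))"
      if d: "good E ?B d" "\<And>y. y \<in> ?B \<Longrightarrow> y \<noteq> x \<Longrightarrow> d y = c y" for d
    proof -
      let ?d = "d(z := ?k)"
      have sub: "good E C ?d" if "C \<subseteq> ?B" for C
        by (rule good_cong_subset[OF d(1) that]) (use that in auto)
      have LA: "?L \<subseteq> A"
        by (auto simp: alive_def)
      have df: "?d f = c f" if "f \<in> ?L" "f \<noteq> z" "f \<noteq> ?x"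
        using that d(2) True LA by auto
      from f show ?thesis
      proof
        assume *: "\<forall>y\<in>?L. (z, y) \<in> E \<longrightarrow> y = f"
        have "?d y \<noteq> ?d z" if y: "y \<in> ?L" "(z, y) \<in> E" for y
        proof -
          have "y = f" "y \<noteq> z" "y \<noteq> ?x"
            using * y inz(2) asym by blast+
          then show ?thesis
            using df y by simp
        qed
        then show ?thesis
          using sub[of "?L - {z}"] LA by (intro good_remove[of E ?L "{z}"]) auto
      next
        assume *: "\<forall>y\<in>?L. (y, ?x) \<in> E \<longrightarrow> y = f"
        show ?thesis
        proof (cases "?d ?x = ?k")
          case False
          then have "?d y \<noteq> ?d z" if "y \<in> ?L" "(y, z) \<in> E" for y
            using inz(1)[of y] that LA by auto
          then show ?thesis
            using sub[of "?L - {z}"] LA by (intro good_remove[of E ?L "{z}"]) auto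
        next
          \<comment> \<open>Here \<open>sp z\<close> itself is harmless, its only relevant
            in-neighbour \<open>f\<close> having the other colour; without \<open>sp z\<close>, the
            vertex \<open>z\<close> has no in-neighbour.\<close>
          case True
          have "?d y \<noteq> ?d ?x" if y: "y \<in> ?L" "(y, ?x) \<in> E" for y
          proof -
            have "y = f" "y \<noteq> z" "y \<noteq> ?x"
              using * y inz(2) asym by blast+
            then show ?thesis
              using df y True by simp
          qed
          moreover have "good E (?L - {?x}) ?d"
            using sub[of "?L - {?x} - {z}"] LA inz(1)
            by (intro good_remove[of E "?L - {?x}" "{z}"]) auto
          ultimately show ?thesis
            by (intro good_remove[of E ?L "{?x}"]) auto
        qed
      qed
    qed
    show ?thesis
    proof (rule linked_canon_alive[OF sp, of ?x])
      show "good E ?L (c(z := ?k))" "good E ?L (c'(z := ?k))"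
        using adj agree by (auto simp: adj_def intro!: good)
    qed (use agree True z in \<open>auto simp: alive_def\<close>)
  qed
qed auto

text \<open>
  If \<open>u\<close> has at most one unsupported neighbour \<open>t\<close>, its supported neighbours can first be arranged so
  that all in-neighbours share one colour and all out-neighbours the other; then \<open>u\<close> can be recoloured.
\<close>

lemma mix_delete_free:
  assumes sp: "supported E A S sp" and "asym E" and u: "u \<in> A - S"
    and t: "\<And>y. y \<in> A - S \<Longrightarrow> (y, u) \<in> E \<or> (u, y) \<in> E \<Longrightarrow> y = t"
    and side: "\<And>x. x \<in> A - S - {u} \<Longrightarrow> \<exists>f. f \<noteq> x \<and>
      ((\<forall>y\<in>alive A S sp x. (y, u) \<in> E \<longrightarrow> y = f) \<or> (\<forall>y\<in>alive A S sp x. (u, y) \<in> E \<longrightarrow> y = f))"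
    and "mix E (A - insert u {v \<in> S. sp v = u})" "\<exists>c. good E A c"
  shows "mix E A"
proof (rule mix_lift[OF sp _ assms(6,7)])
  let ?B = "A - insert u {v \<in> S. sp v = u}"
  have asym: "(b, a) \<notin> E" if "(a, b) \<in> E" for a b
    using \<open>asym E\<close> that by (auto dest: asymD)
  have free: "linked E A (canon S sp (c(u := b))) (canon S sp (c(u := b')))"
    if c: "good E ?B c" for c b b'
  proof -
    \<comment> \<open>In-neighbours of \<open>u\<close> are to get \<open>?p\<close> and
      out-neighbours the opposite colour; the prescribed colour of \<open>t\<close> decides which
      value works. Then \<open>u\<close> has no monochromatic out-arc in colour \<open>?p\<close>,
      and no monochromatic in-arc in the other.\<close>
    let ?p = "if (t, u) \<in> E then c t else \<not> c t"
    let ?L = "alive A S sp u"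
    define d where "d v = (if v \<in> S then (if (v, u) \<in> E then ?p else \<not> ?p) else c v)" for v
    have good: "good E ?L (d(u := b))" for b
    proof (rule good_remove[where D="{u}"], rule good_remove[where D=S])
      show "good E (?L - {u} - S) (d(u := b))"
        by (rule good_cong_subset[OF c]) (auto simp: alive_def d_def)
      show "(\<forall>y\<in>?L - {u}. (y, z) \<in> E \<longrightarrow> (d(u := b)) y \<noteq> (d(u := b)) z) \<or>
        (\<forall>y\<in>?L - {u}. (z, y) \<in> E \<longrightarrow> (d(u := b)) y \<noteq> (d(u := b)) z)"
        if "z \<in> S" "z \<in> ?L - {u}" for z
        using sp that by (fastforce simp: supported_def alive_def)
      have "d y = ?p" if "y \<in> ?L" "(y, u) \<in> E" for y
        using t[of y] that by (auto simp: alive_def d_def)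
      moreover have "d y = (\<not> ?p)" if "y \<in> ?L" "(u, y) \<in> E" for y
        using t[of y] asym that by (auto simp: alive_def d_def)
      ultimately show "(\<forall>y\<in>?L. (y, z) \<in> E \<longrightarrow> (d(u := b)) y \<noteq> (d(u := b)) z) \<or>
        (\<forall>y\<in>?L. (z, y) \<in> E \<longrightarrow> (d(u := b)) y \<noteq> (d(u := b)) z)"
        if "z \<in> {u}" "z \<in> ?L" for z
        using that asym by (cases "b = ?p") (smt (verit) fun_upd_apply singletonD)+
    qed
    show ?thesis
      by (rule linked_canon_alive[OF sp good[of b] good[of b']]) (auto simp: d_def)
  qed
  fix c c'
  assume adj: "adj E ?B c c'"
  then obtain x where agree: "\<And>y. y \<in> ?B \<Longrightarrow> y \<noteq> x \<Longrightarrow> c y = c' y"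
    by (auto simp: adj_def)
  have ends: "good E ?B c" "good E ?B c'"
    using adj by (auto simp: adj_def)
  have "\<exists>b. linked E A (canon S sp (c(u := b))) (canon S sp (c'(u := b)))"
  proof (cases "x \<in> A - S - {u}")
    case True
    let ?L = "alive A S sp x"
    obtain f where f: "f \<noteq> x"
      "(\<forall>y\<in>?L. (y, u) \<in> E \<longrightarrow> y = f) \<or> (\<forall>y\<in>?L. (u, y) \<in> E \<longrightarrow> y = f)"
      using side True by blast
    have LB: "?L - {u} \<subseteq> ?B"
      using True by (auto simp: alive_def)
    \<comment> \<open>Since \<open>f\<close> differs from \<open>x\<close>, it keeps its colour in
      this step, so one colour of \<open>u\<close>, opposite to that of \<open>f\<close>, makes
      \<open>u\<close> harmless at both ends.\<close>
    have good: "good E ?L (d(u := \<not> c f))"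
      if d: "good E ?B d" "\<And>y. y \<in> ?B \<Longrightarrow> y \<noteq> x \<Longrightarrow> d y = c y" for d
    proof (rule good_remove[where D="{u}"])
      show "good E (?L - {u}) (d(u := \<not> c f))"
        by (rule good_cong_subset[OF d(1) LB]) auto
      fix z assume "z \<in> {u}" "z \<in> ?L"
      moreover have "f \<noteq> u \<and> d f = c f" if "f \<in> ?L" "(f, u) \<in> E \<or> (u, f) \<in> E"
        using that f(1) d(2) LB asym by blast
      ultimately show "(\<forall>y\<in>?L. (y, z) \<in> E \<longrightarrow> (d(u := \<not> c f)) y \<noteq> (d(u := \<not> c f)) z) \<or>
        (\<forall>y\<in>?L. (z, y) \<in> E \<longrightarrow> (d(u := \<not> c f)) y \<noteq> (d(u := \<not> c f)) z)"
        using f(2) by auto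
    qed
    have "linked E A (canon S sp (c(u := \<not> c f))) (canon S sp (c'(u := \<not> c f)))"
      by (rule linked_canon_alive[OF sp good good]) (use ends agree LB in auto)
    then show ?thesis by blast
  next
    case False
    let ?c = "c(u := \<not> c t)" and ?c' = "c'(u := \<not> c t)"
    have "good E (A - S) ?c"
    proof (rule good_remove[where D="{u}"])
      show "good E (A - S - {u}) ?c"
        by (rule good_cong_subset[OF ends(1)]) auto
    qed (use t asym in auto)
    then have "good E A (canon S sp ?c)"
      by (rule good_canon[OF sp subset_refl])
    moreover have agree': "?c v = ?c' v" if "v \<in> A - S" for v
      using agree[of v] that False by auto
    have "canon S sp ?c v = canon S sp ?c' v" if "v \<in> A" for v
      using that sp agree' unfolding canon_def supported_def by (metis DiffI)
    ultimately show ?thesis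
      using adj_agree by blast
  qed
  then obtain b where "linked E A (canon S sp (c(u := b))) (canon S sp (c'(u := b)))" ..
  moreover have "linked E A (canon S sp c) (canon S sp (c(u := b)))"
    using free[OF ends(1), of "c u"] by simp
  moreover have "linked E A (canon S sp (c'(u := b))) (canon S sp c')"
    using free[OF ends(2), of _ "c' u"] by simp
  ultimately show "linked E A (canon S sp c) (canon S sp c')"
    by (meson rtranclp_trans)
qed auto

text \<open>
  With \<open>p\<close> and \<open>z\<close> coloured differently, the two can exchange their colours whenever the two
  in-neighbours of \<open>p\<close> agree. They agree in some reachable colouring: otherwise no recolouring step could change either of them, and swapping
  the two colours globally would be impossible.
\<close>

lemma mix_delete_pair:
  assumes "asym E" and p: "p \<in> A" and z: "z \<in> A" "(p, z) \<in> E"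
    and inz': "\<forall>y\<in>A. (y, z) \<in> E \<longrightarrow> y = p"
    and outp': "\<forall>y\<in>A. (p, y) \<in> E \<longrightarrow> y = z"
    and t': "\<forall>y\<in>A. (y, p) \<in> E \<longrightarrow> y = t \<or> y = t'"
    and tB: "t \<in> A - {p, z}" "t' \<in> A - {p, z}"
    and "mix E (A - {p, z})" "\<exists>c. good E A c"
  shows "mix E A"
proof -
  note inz = inz'[rule_format] and outp = outp'[rule_format] and t = t'[rule_format]
  let ?B = "A - {p, z}"
  \<comment> \<open>Opposite colours on \<open>p\<close> and \<open>z\<close> make the only out-arc
    of \<open>p\<close> and the only in-arc of \<open>z\<close> harmless, so every good colouring of
    \<open>?B\<close> extends, for either \<open>b\<close>.\<close>
  define K where "K b c = canon {z} (\<lambda>_. p) (c(p := b))" for b and c :: "'a \<Rightarrow> bool"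
  have asym: "(b, a) \<notin> E" if "(a, b) \<in> E" for a b
    using \<open>asym E\<close> that by (auto dest: asymD)
  have "p \<noteq> z"
    using z asym by blast
  then have sp: "supported E A {z} (\<lambda>_. p)"
    using p z unfolding supported_def by (simp, blast intro: inz)
  have goodK: "good E A (K b c)" if "good E ?B c" for b c
    unfolding K_def
  proof (rule good_canon[OF sp subset_refl], rule good_remove[where D="{p}"])
    show "good E (A - {z} - {p}) (c(p := b))"
      by (rule good_cong_subset[OF that]) auto
    show "(\<forall>y\<in>A - {z}. (y, v) \<in> E \<longrightarrow> (c(p := b)) y \<noteq> (c(p := b)) v) \<or>
      (\<forall>y\<in>A - {z}. (v, y) \<in> E \<longrightarrow> (c(p := b)) y \<noteq> (c(p := b)) v)" if "v \<in> {p}" for v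
      using outp that by blast
  qed
  have stepK: "linked E A (K b c) (K b c')" if adj: "adj E ?B c c'" for b c c'
  proof -
    obtain x where "\<And>y. y \<in> ?B \<Longrightarrow> y \<noteq> x \<Longrightarrow> c y = c' y"
      using adj by (auto simp: adj_def)
    then have "K b c v = K b c' v" if "v \<in> A" "v \<noteq> x" for v
      using that by (auto simp: K_def canon_def)
    moreover have "good E A (K b c)" "good E A (K b c')"
      using adj goodK by (auto simp: adj_def)
    ultimately show ?thesis
      using adj_flip by metis
  qed
  have pathK: "linked E A (K b c) (K b c')" if "good E ?B c" "good E ?B c'" for b c c'
  proof -
    have "linked E ?B c c'"
      using that assms(10) by (auto simp: mix_def)
    then show ?thesis
      by (induction rule: rtranclp_induct) (auto intro: stepK rtranclp_trans)
  qed
  have "\<exists>e. good E ?B e \<and> e t = e t'"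
  proof (rule ccontr)
    assume no: "\<nexists>e. good E ?B e \<and> e t = e t'"
    obtain c where c: "good E ?B c"
      using assms(10) by (auto simp: mix_def)
    have "mono_arcs E ?B (\<lambda>v. \<not> c v) = mono_arcs E ?B c"
      by (auto simp: mono_arcs_def)
    then have "good E ?B (\<lambda>v. \<not> c v)"
      using c by (simp add: good_def)
    then have "linked E ?B c (\<lambda>v. \<not> c v)"
      using c assms(10) by (auto simp: mix_def)
    moreover have "e t = c t" if "linked E ?B c e" for e
      using that
    proof (induction rule: rtranclp_induct)
      case (step d e)
      then have "d t \<noteq> d t'" "e t \<noteq> e t'"
        using no by (auto simp: adj_def)
      moreover obtain x where "\<And>y. y \<in> ?B \<Longrightarrow> y \<noteq> x \<Longrightarrow> d y = e y"
        using step.hyps by (auto simp: adj_def)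
      then have "d t = e t \<or> d t' = e t'"
        using tB calculation by metis
      ultimately show ?case
        using step.IH by auto
    qed simp
    ultimately show False
      by blast
  qed
  then obtain e where e: "good E ?B e" "e t = e t'"
    by blast
  have flip_e: "linked E A (K b e) (K b' e)" for b b'
  proof -
    \<comment> \<open>\<open>z\<close> is coloured unlike \<open>t\<close> and \<open>t'\<close>. If
      \<open>p\<close> agrees with \<open>t\<close>, its out-arc to \<open>z\<close> is not
      monochromatic; otherwise none of its in-arcs is.\<close>
    let ?d = "\<lambda>b. e(z := \<not> e t, p := b)"
    have "alive A {z} (\<lambda>_. p) p = A"
      by (auto simp: alive_def)
    moreover have "good E A (?d b)" for b
    proof (rule good_remove[where D="{p}"], rule good_remove[where D="{z}"])
      show "good E (A - {p} - {z}) (?d b)"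
        by (rule good_cong_subset[OF e(1)]) auto
      show "(\<forall>y\<in>A. (y, v) \<in> E \<longrightarrow> ?d b y \<noteq> ?d b v) \<or> (\<forall>y\<in>A. (v, y) \<in> E \<longrightarrow> ?d b y \<noteq> ?d b v)"
        if "v \<in> {p}" for v
      proof (cases "b = e t")
        case True
        then have "\<forall>y\<in>A. (v, y) \<in> E \<longrightarrow> ?d b y \<noteq> ?d b v"
          using that \<open>p \<noteq> z\<close> by (auto dest: outp)
        then show ?thesis ..
      next
        case False
        then have "\<forall>y\<in>A. (y, v) \<in> E \<longrightarrow> ?d b y \<noteq> ?d b v"
          using that tB e(2) by (auto dest!: t)
        then show ?thesis ..
      qed
      show "(\<forall>y\<in>A - {p}. (y, v) \<in> E \<longrightarrow> ?d b y \<noteq> ?d b v) \<or>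
        (\<forall>y\<in>A - {p}. (v, y) \<in> E \<longrightarrow> ?d b y \<noteq> ?d b v)" if "v \<in> {z}" for v
        using inz that by blast
    qed
    ultimately show ?thesis
      unfolding K_def
      by (intro linked_canon_alive[OF sp, of p "?d b" "?d b'"]) auto
  qed
  show ?thesis
  proof (rule mix_lift[OF sp _ assms(10,11)])
    fix c c'
    assume adj: "adj E ?B c c'"
    then have c: "good E ?B c" "good E ?B c'"
      by (auto simp: adj_def)
    have "linked E A (K (c p) c) (K (c p) e)"
      by (rule pathK[OF c(1) e(1)])
    also have "linked E A \<dots> (K (c' p) e)"
      by (rule flip_e)
    also have "linked E A \<dots> (K (c' p) c')"
      by (rule pathK[OF e(1) c(2)])
    finally show "linked E A (canon {z} (\<lambda>_. p) c) (canon {z} (\<lambda>_. p) c')"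
      by (simp add: K_def)
  qed auto
qed

section \<open>Minimal non-mixing digraphs\<close>

definition preds :: "'a rel \<Rightarrow> 'a set \<Rightarrow> 'a \<Rightarrow> 'a set" where
  "preds E A v = {y \<in> A. (y, v) \<in> E}"

definition succs :: "'a rel \<Rightarrow> 'a set \<Rightarrow> 'a \<Rightarrow> 'a set" where
  "succs E A v = {y \<in> A. (v, y) \<in> E}"

text \<open>Good colourability is required in addition because \<open>mix\<close> also fails for
  lack of colourings; minimal uncolourable sets are handled by
  \<open>uncolourable_dense\<close>.\<close>

definition critical :: "'a rel \<Rightarrow> 'a set \<Rightarrow> bool" where
  "critical E A \<longleftrightarrow> finite A \<and> asym E \<and> \<not> mix E A \<and> (\<forall>B. B \<subset> A \<longrightarrow> mix E B) \<and> (\<exists>c. good E A c)"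

lemma critical_converse: "critical (E\<inverse>) A = critical E A"
proof -
  have "asym (E\<inverse>) = asym E"
    by (auto simp: asym_iff)
  then show ?thesis
    by (simp add: critical_def mix_converse good_converse)
qed

lemma preds_converse: "preds (E\<inverse>) = succs E" and succs_converse: "succs (E\<inverse>) = preds E"
  by (auto simp: preds_def succs_def fun_eq_iff)

lemma finite_preds: "finite A \<Longrightarrow> finite (preds E A v)"
  and finite_succs: "finite A \<Longrightarrow> finite (succs E A v)"
  by (auto simp: preds_def succs_def)

lemma critical_preds_nonempty:
  assumes "critical E A" "v \<in> A"
  shows "preds E A v \<noteq> {}"
proof
  assume "preds E A v = {}"
  moreover have "mix E (A - {v})"
    using assms by (auto simp: critical_def)
  ultimately have "mix E A"
    by (intro mix_delete_source[of E A v]) (auto simp: preds_def)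
  then show False
    using assms by (simp add: critical_def)
qed

lemma critical_succs_nonempty:
  assumes "critical E A" "v \<in> A"
  shows "succs E A v \<noteq> {}"
  using critical_preds_nonempty[of "E\<inverse>" A v] assms by (simp add: critical_converse preds_converse)

lemma card_le_1E:
  assumes "finite X" "card X < 2"
  obtains f where "X \<subseteq> {f}"
proof (cases "X = {}")
  case False
  then have "card X = 1"
    using assms by (metis One_nat_def Suc_1 Suc_leI card_gt_0_iff le_antisym less_Suc_eq_le)
  then show ?thesis
    using that by (metis card_1_singletonE subset_refl)
qed (use that in auto)

text \<open>With \<open>z\<close> as the only supported vertex, every vertex is alive. If
  \<open>z\<close> had at most one out-neighbour or \<open>p\<close> at most one in-neighbour,
  \<open>mix_delete_supported\<close> would make \<open>A\<close> mixing.\<close>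

lemma critical_single_pred:
  assumes "critical E A" "z \<in> A" "preds E A z = {p}"
  shows "2 \<le> card (succs E A z)" "2 \<le> card (preds E A p)"
proof -
  have p: "p \<in> A" "(p, z) \<in> E" and inz: "\<forall>y\<in>A. (y, z) \<in> E \<longrightarrow> y = p"
    using assms(3) by (auto simp: preds_def)
  have crit: "asym E" "finite A" "mix E (A - {z})" "\<exists>c. good E A c" "\<not> mix E A"
    using assms by (auto simp: critical_def)
  have "p \<noteq> z"
    using p crit(1) by (auto dest: asymD)
  then have sp: "supported E A {z} (\<lambda>_. p)"
    using p assms(2) unfolding supported_def by (simp, use inz in blast)
  have no: "\<not> (\<exists>f. succs E A z \<subseteq> {f} \<or> preds E A p \<subseteq> {f})"
  proof
    assume "\<exists>f. succs E A z \<subseteq> {f} \<or> preds E A p \<subseteq> {f}"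
    then obtain f where "succs E A z \<subseteq> {f} \<or> preds E A p \<subseteq> {f}" ..
    then have "(\<forall>y\<in>alive A {z} (\<lambda>_. p) p. (z, y) \<in> E \<longrightarrow> y = f) \<or>
      (\<forall>y\<in>alive A {z} (\<lambda>_. p) p. (y, p) \<in> E \<longrightarrow> y = f)"
      by (auto simp: succs_def preds_def alive_def)
    then have "mix E A"
      by (rule mix_delete_supported[OF sp crit(1) singletonI inz p(2) _ crit(3,4)])
    then show False
      using crit by simp
  qed
  show "2 \<le> card (succs E A z)"
    using no card_le_1E[OF finite_succs[OF crit(2)]] by (meson not_less)
  show "2 \<le> card (preds E A p)"
    using no card_le_1E[OF finite_preds[OF crit(2)]] by (meson not_less)
qed

section \<open>Degrees in a critical digraph\<close>

definition nb :: "'a rel \<Rightarrow> 'a set \<Rightarrow> 'a \<Rightarrow> 'a set" where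
  "nb E A v = preds E A v \<union> succs E A v"

lemma nb_converse: "nb (E\<inverse>) = nb E"
  by (auto simp: nb_def preds_converse succs_converse fun_eq_iff)

lemma preds_succs_disjoint: "asym E \<Longrightarrow> preds E A v \<inter> succs E A v = {}"
  by (auto simp: preds_def succs_def dest: asymD)

lemma card_nb:
  assumes "finite A" "asym E"
  shows "card (nb E A v) = card (preds E A v) + card (succs E A v)"
  unfolding nb_def using assms
  by (intro card_Un_disjoint finite_preds finite_succs preds_succs_disjoint)

lemma critical_degree:
  assumes "critical E A" "v \<in> A"
  shows "3 \<le> card (nb E A v)"
proof -
  have "finite A" "asym E"
    using assms by (auto simp: critical_def)
  have "card (preds E A v) \<noteq> 0" "card (succs E A v) \<noteq> 0"
    using critical_preds_nonempty[OF assms] critical_succs_nonempty[OF assms]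
      finite_preds[OF \<open>finite A\<close>] finite_succs[OF \<open>finite A\<close>] by auto
  moreover have "2 \<le> card (succs E A v)" if "card (preds E A v) = 1"
    using critical_single_pred[OF assms] that by (auto simp: card_1_singleton_iff)
  ultimately show ?thesis
    unfolding card_nb[OF \<open>finite A\<close> \<open>asym E\<close>] by linarith
qed

text \<open>By \<open>critical_single_pred\<close>, \<open>p\<close> has at least two in-neighbours.
  With degree 3 it has exactly two, \<open>z\<close> is its only out-neighbour, and
  \<open>mix_delete_pair\<close> applies.\<close>

lemma critical_pred_degree:
  assumes crit: "critical E A" and z: "z \<in> A" "preds E A z = {p}"
  shows "card (nb E A p) \<noteq> 3"
proof
  assume 3: "card (nb E A p) = 3"
  have A: "finite A" "asym E" "\<exists>c. good E A c" "\<not> mix E A"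
    using crit by (auto simp: critical_def)
  have asym: "(b, a) \<notin> E" if "(a, b) \<in> E" for a b
    using \<open>asym E\<close> that by (auto dest: asymD)
  have p: "p \<in> A" "(p, z) \<in> E"
    using z by (auto simp: preds_def)
  have "card (succs E A p) \<noteq> 0"
    using critical_succs_nonempty[OF crit p(1)] finite_succs[OF A(1)] by auto
  then have "card (preds E A p) = 2" "card (succs E A p) = 1"
    using critical_single_pred[OF crit z] 3 card_nb[OF A(1,2), of p] by auto
  moreover have "z \<in> succs E A p"
    using p z by (auto simp: succs_def)
  ultimately obtain t t' where t: "preds E A p = {t, t'}" and outp: "succs E A p = {z}"
    by (metis card_1_singletonE card_2_iff singletonD)
  have "\<forall>y\<in>A. (y, z) \<in> E \<longrightarrow> y = p" "\<forall>y\<in>A. (p, y) \<in> E \<longrightarrow> y = z"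
    "\<forall>y\<in>A. (y, p) \<in> E \<longrightarrow> y = t \<or> y = t'"
    using z(2) outp t unfolding preds_def succs_def by blast+
  note nbs = this
  have "{t, t'} \<subseteq> A" "(t, p) \<in> E" "(t', p) \<in> E"
    using t unfolding preds_def by blast+
  then have tB: "t \<in> A - {p, z}" "t' \<in> A - {p, z}"
    using p(2) asym by auto
  have "A - {p, z} \<subset> A"
    using z by blast
  then have "mix E (A - {p, z})"
    using crit unfolding critical_def by blast
  then have "mix E A"
    by (rule mix_delete_pair[OF A(2) p(1) z(1) p(2) nbs tB _ A(3)])
  then show False
    using A by simp
qed

lemma critical_succ_degree:
  assumes "critical E A" "z \<in> A" "succs E A z = {p}"
  shows "card (nb E A p) \<noteq> 3"
  using critical_pred_degree[of "E\<inverse>" A z p] assms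
  by (simp add: critical_converse preds_converse nb_converse)

text \<open>A vertex outside the alive set is harmless while \<open>sp z\<close> is recoloured. If
  one of the two out-neighbours of \<open>z\<close> were such a vertex, at most one relevant
  out-neighbour would be left and \<open>z\<close> could be deleted.\<close>

lemma critical_succs_alive:
  assumes crit: "critical E A" and sp: "supported E A S sp"
    and z: "z \<in> S" "preds E A z = {sp z}" "card (succs E A z) = 2"
  shows "succs E A z \<subseteq> alive A S sp (sp z)"
proof (rule ccontr)
  assume "\<not> succs E A z \<subseteq> alive A S sp (sp z)"
  moreover obtain g h where "succs E A z = {g, h}"
    using z(3) by (auto simp: card_2_iff)
  ultimately obtain f where "succs E A z \<inter> alive A S sp (sp z) \<subseteq> {f}"
    by auto
  moreover have "alive A S sp (sp z) \<subseteq> A"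
    by (auto simp: alive_def)
  ultimately have f: "\<forall>y\<in>alive A S sp (sp z). (z, y) \<in> E \<longrightarrow> y = f"
    by (auto simp: succs_def)
  have "A - {z} \<subset> A"
    using sp z(1) unfolding supported_def by blast
  then have A: "mix E (A - {z})" "asym E" "\<exists>c. good E A c"
    using crit unfolding critical_def by blast+
  have inz: "\<forall>y\<in>A. (y, z) \<in> E \<longrightarrow> y = sp z"
    using z(2) unfolding preds_def by blast
  have "(sp z, z) \<in> E"
    using z(2) unfolding preds_def by blast
  note del = mix_delete_supported[OF sp A(2) z(1) inz this]
  have "mix E A"
    by (rule del[of f]) (use f A in simp_all)
  then show False
    using crit by (simp add: critical_def)
qed

lemma critical_preds_alive:
  assumes "critical E A" "supported E A S sp"
    and "z \<in> S" "succs E A z = {sp z}" "card (preds E A z) = 2"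
  shows "preds E A z \<subseteq> alive A S sp (sp z)"
  using critical_succs_alive[of "E\<inverse>" A S sp z] assms
  by (simp add: critical_converse preds_converse succs_converse supported_converse)

section \<open>Discharging\<close>

text \<open>
  Every vertex \<open>v\<close> has charge \<open>8 * deg v - 28\<close>, so only the vertices of \<open>S\<close>, of charge \<open>-4\<close>, are in
  debt. They receive \<open>2\<close> for each neighbour \<open>g\<close> other than their supporter \<open>sp z\<close>: from \<open>sp z\<close> if
  \<open>g \<in> S\<close>; otherwise from \<open>g\<close>, with \<open>sp z\<close> taking over one unit if it is thick.
\<close>

lemma discharging:
  fixes nb :: "'a \<Rightarrow> 'a set" and sp :: "'a \<Rightarrow> 'a" and thick :: "'a \<Rightarrow> bool"
  assumes fin: "finite S" "finite W" "S \<inter> W = {}"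
    and nb: "\<And>v. v \<in> S \<union> W \<Longrightarrow> nb v \<subseteq> S \<union> W - {v}"
    and sym: "\<And>v w. v \<in> S \<union> W \<Longrightarrow> w \<in> nb v \<Longrightarrow> v \<in> nb w"
    and S: "\<And>z. z \<in> S \<Longrightarrow> card (nb z) = 3" "\<And>z. z \<in> S \<Longrightarrow> sp z \<in> W \<inter> nb z"
    and W: "\<And>w. w \<in> W \<Longrightarrow> 4 \<le> card (nb w)"
    and partner: "\<And>z g. z \<in> S \<Longrightarrow> g \<in> nb z \<Longrightarrow> g \<in> S \<Longrightarrow> sp g = sp z"
    and thick_pair: "\<And>w. w \<in> W \<Longrightarrow> thick w \<Longrightarrow> \<exists>z\<in>S. \<exists>z'\<in>S. z \<noteq> z' \<and> sp z = w \<and> sp z' = w \<and> z' \<notin> nb z"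
    and free: "\<And>u. u \<in> W \<Longrightarrow> card (nb u \<inter> W) \<le> 1 \<Longrightarrow> \<exists>x\<in>W - {u}. thick x \<and>
      2 \<le> card (nb u \<inter> {z \<in> S. sp z = x}) \<and>
      (nb u \<inter> W = {} \<longrightarrow> 4 \<le> card (nb u \<inter> {z \<in> S. sp z = x}))"
  shows "28 * card (S \<union> W) \<le> 8 * (\<Sum>v\<in>S \<union> W. card (nb v))"
proof -
  \<comment> \<open>Both \<open>out w\<close> and \<open>inc w\<close> are paid by \<open>w\<close>:
    the first to the vertices it supports, the second to its other neighbours in \<open>S\<close>.
    The rates are \<open>h\<close> and \<open>k\<close>.\<close>
  define U where "U w = {z \<in> S. sp z = w}" for w
  define X where "X w = {z \<in> nb w \<inter> S. sp z \<noteq> w}" for w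
  define h where "h w g = (if g \<in> S then 2 else if thick w then 1 else 0 :: nat)" for w g
  define k where "k z = (if thick (sp z) then 1 else 2 :: nat)" for z
  define out where "out w = (\<Sum>z\<in>U w. \<Sum>g\<in>nb z - {w}. h w g)" for w
  define inc where "inc w = (\<Sum>z\<in>X w. k z)" for w
  have fin_nb: "finite (nb v)" if "v \<in> S \<union> W" for v
    using nb[OF that] fin finite_subset by blast
  have fin_U: "finite (U w)" for w
    using fin by (simp add: U_def)
  have fin_X: "finite (X w)" for w
    using fin by (auto simp: X_def)
  have slots: "card (nb z - {w}) = 2" "finite (nb z - {w})" if "z \<in> U w" for z w
    using that S fin_nb[of z] by (auto simp: U_def card_Diff_singleton)
  have partnerU: "g \<in> U w - {z}" if "z \<in> U w" "g \<in> nb z - {w}" "g \<in> S" for z w g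
    using that partner[of z g] nb[of z] by (auto simp: U_def)
  have split: "card (nb w) = card (U w) + card (X w) + card (nb w \<inter> W)" if "w \<in> W" for w
  proof -
    have "U w \<subseteq> nb w"
      using S(2) sym by (force simp: U_def)
    then have "nb w = U w \<union> X w \<union> (nb w \<inter> W)"
      using nb[of w] that by (auto simp: U_def X_def)
    moreover have "card (U w \<union> X w \<union> (nb w \<inter> W)) = card (U w \<union> X w) + card (nb w \<inter> W)"
      using fin fin_U fin_X by (intro card_Un_disjoint) (auto simp: U_def X_def)
    moreover have "card (U w \<union> X w) = card (U w) + card (X w)"
      using fin_U fin_X by (intro card_Un_disjoint) (auto simp: U_def X_def)
    ultimately show ?thesis by simp
  qed
  have sum_le: "sum f Y \<le> c * card Y" if "\<And>y. y \<in> Y \<Longrightarrow> f y \<le> c" for f :: "'a \<Rightarrow> nat" and Y c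
    using sum_bounded_above[of Y f c] that by (simp add: mult.commute)
  have inc_le: "inc w \<le> 2 * card (X w)" for w
    unfolding inc_def by (rule sum_le) (simp add: k_def)
  have inc_thick: "inc w + card (nb w \<inter> U x) \<le> 2 * card (X w)" "card (nb w \<inter> U x) \<le> card (X w)"
    if "x \<noteq> w" "thick x" for w x
  proof -
    let ?Y = "nb w \<inter> U x"
    have sub: "?Y \<subseteq> X w"
      using that by (auto simp: X_def U_def)
    then show "card ?Y \<le> card (X w)"
      using fin_X by (intro card_mono)
    have "inc w = sum k (X w - ?Y) + sum k ?Y"
      unfolding inc_def using sub fin_X by (intro sum.subset_diff)
    moreover have "sum k ?Y = card ?Y"
      using that by (simp add: k_def U_def)
    moreover have "sum k (X w - ?Y) \<le> 2 * card (X w - ?Y)"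
      by (rule sum_le) (simp add: k_def)
    moreover have "card (X w - ?Y) = card (X w) - card ?Y"
      using sub fin_X by (meson card_Diff_subset finite_subset)
    moreover have "card ?Y \<le> card (X w)"
      by fact
    ultimately show "inc w + card ?Y \<le> 2 * card (X w)"
      by linarith
  qed
  have out_le: "out w \<le> 4 * card (U w)" for w
  proof -
    have "(\<Sum>g\<in>nb z - {w}. h w g) \<le> 4" if "z \<in> U w" for z
      using sum_le[of "nb z - {w}" "h w" 2] slots[OF that] by (simp add: h_def)
    then show ?thesis
      unfolding out_def by (rule sum_le)
  qed
  \<comment> \<open>A neighbour in \<open>S\<close> of the only supported vertex would have the
    supporter \<open>w\<close> as well, and a thick \<open>w\<close> would support two
    vertices.\<close>
  have out_1: "out w = 0" if w: "w \<in> W" "card (U w) = 1" for w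
  proof -
    obtain z where z: "U w = {z}"
      using w(2) by (rule card_1_singletonE)
    have "\<not> thick w"
    proof
      assume "thick w"
      then obtain a b where "a \<noteq> b" "{a, b} \<subseteq> U w"
        using thick_pair[OF w(1)] by (auto simp: U_def)
      then show False
        using z by auto
    qed
    moreover have "g \<notin> S" if "g \<in> nb z - {w}" for g
      using partnerU[of z w g] that z by auto
    ultimately have "h w g = 0" if "g \<in> nb z - {w}" for g
      using that by (simp add: h_def)
    then show ?thesis
      unfolding out_def using z by (auto intro!: sum.neutral)
  qed
  \<comment> \<open>If \<open>w\<close> is thick, its two supported vertices are non-adjacent and
    cost 1 for each of their two neighbours other than \<open>w\<close>. Otherwise a supported
    vertex costs something only through the other one, namely 2.\<close>
  have out_2: "out w \<le> 4" if w: "w \<in> W" "card (U w) = 2" for w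
  proof -
    have "(\<Sum>g\<in>nb z - {w}. h w g) \<le> 2" if z: "z \<in> U w" for z
    proof (cases "thick w")
      case True
      then obtain a b where ab: "a \<noteq> b" "{a, b} \<subseteq> U w" "b \<notin> nb a"
        using thick_pair[OF w(1)] by (auto simp: U_def)
      then have U: "U w = {a, b}"
        using w(2) fin_U by (metis card_2_iff card_subset_eq)
      have "a \<notin> nb b"
        using ab sym[of b a] by (auto simp: U_def)
      then have "g \<notin> S" if "g \<in> nb z - {w}" for g
        using partnerU[OF z that] that z ab(3) U by auto
      then have "(\<Sum>g\<in>nb z - {w}. h w g) = (\<Sum>g\<in>nb z - {w}. 1)"
        using True by (intro sum.cong) (auto simp: h_def)
      then show ?thesis
        using slots[OF z] by simp
    next
      case False
      have "card (U w - {z}) = 1"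
        using z w(2) fin_U by (simp add: card_Diff_singleton)
      moreover have "(nb z - {w}) \<inter> S \<subseteq> U w - {z}"
        using partnerU[OF z] by blast
      ultimately have "card ((nb z - {w}) \<inter> S) \<le> 1"
        using fin_U by (metis card_mono finite_Diff)
      moreover have "(\<Sum>g\<in>nb z - {w}. h w g) = (\<Sum>g\<in>(nb z - {w}) \<inter> S. 2)"
        using slots[OF z] False by (simp add: h_def sum.inter_restrict del: sum_constant)
      ultimately show ?thesis
        by simp
    qed
    then have "out w \<le> 2 * card (U w)"
      unfolding out_def by (rule sum_le)
    then show ?thesis
      using w(2) by simp
  qed
  have bound: "inc w + out w + 28 \<le> 8 * card (nb w)" if w: "w \<in> W" for w
  proof -
    let ?s = "card (U w)" and ?e = "card (X w)" and ?d = "card (nb w \<inter> W)"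
    have D: "card (nb w) = ?s + ?e + ?d" "4 \<le> card (nb w)"
      using split W w by auto
    have fr: "2 \<le> ?e" "inc w + 2 \<le> 2 * ?e" if "?d \<le> 1"
      using free[OF w that] inc_thick[of _ w] unfolding U_def[symmetric] by fastforce+
    have fr0: "4 \<le> ?e" "inc w + 4 \<le> 2 * ?e" if "?d = 0"
    proof -
      have "nb w \<inter> W = {}"
        using that fin by simp
      then show "4 \<le> ?e" "inc w + 4 \<le> 2 * ?e"
        using free[OF w] inc_thick[of _ w] unfolding U_def[symmetric] by fastforce+
    qed
    show ?thesis
    \<comment> \<open>From degree 5 on, the crude bounds \<open>inc_le\<close> and
      \<open>out_le\<close> fit the budget \<open>8 * card (nb w) - 28\<close>, given the lower
      bounds on \<open>?e\<close>. At degree 4 the budget is 4 and the refined bounds are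
      needed.\<close>
    proof (cases "card (nb w) = 4")
      case False
      then show ?thesis
        using D fr(1) fr0(1) inc_le[of w] out_le[of w] by linarith
    next
      case True
      have "?s = 0 \<Longrightarrow> out w = 0"
        using out_le[of w] by simp
      then show ?thesis
        using True D fr fr0 inc_le[of w] out_1[OF w] out_2[OF w] by linarith
    qed
  qed
  \<comment> \<open>Payments are regrouped by the receiving \<open>z\<close> and its neighbours
    \<open>g\<close> other than its supporter; each such pair brings exactly 2.\<close>
  have "(\<Sum>w\<in>W. out w) = (\<Sum>w\<in>W. \<Sum>z\<in>{z \<in> S. sp z = w}. \<Sum>g\<in>nb z - {sp z}. h (sp z) g)"
    unfolding out_def U_def by (intro sum.cong refl) auto
  also have "\<dots> = (\<Sum>z\<in>S. \<Sum>g\<in>nb z - {sp z}. h (sp z) g)"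
    using fin S(2) by (intro sum.group) auto
  finally have sum_out: "(\<Sum>w\<in>W. out w) = (\<Sum>z\<in>S. \<Sum>g\<in>nb z - {sp z}. h (sp z) g)" .
  have "(\<Sum>w\<in>W. inc w) = (\<Sum>w\<in>W. \<Sum>z\<in>{z \<in> S. z \<in> nb w \<and> sp z \<noteq> w}. k z)"
    unfolding inc_def X_def by (intro sum.cong refl) auto
  also have "\<dots> = (\<Sum>z\<in>S. \<Sum>w\<in>{w \<in> W. z \<in> nb w \<and> sp z \<noteq> w}. k z)"
    using fin by (intro sum.swap_restrict)
  also have "\<dots> = (\<Sum>z\<in>S. \<Sum>g\<in>(nb z - {sp z}) \<inter> W. k z)"
  proof (intro sum.cong refl)
    show "{w \<in> W. z \<in> nb w \<and> sp z \<noteq> w} = (nb z - {sp z}) \<inter> W" if "z \<in> S" for z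
      using that sym[of z] sym[of _ z] by auto
  qed
  also have "\<dots> = (\<Sum>z\<in>S. \<Sum>g\<in>nb z - {sp z}. if g \<in> W then k z else 0)"
    using fin_nb by (intro sum.cong refl sum.inter_restrict) auto
  finally have sum_inc: "(\<Sum>w\<in>W. inc w) = (\<Sum>z\<in>S. \<Sum>g\<in>nb z - {sp z}. if g \<in> W then k z else 0)" .
  have "(\<Sum>w\<in>W. inc w + out w) =
      (\<Sum>z\<in>S. \<Sum>g\<in>nb z - {sp z}. (if g \<in> W then k z else 0) + h (sp z) g)"
    by (simp add: sum.distrib sum_inc sum_out)
  also have "\<dots> = (\<Sum>z\<in>S. \<Sum>g\<in>nb z - {sp z}. 2)"
  proof (intro sum.cong refl)
    fix z g
    assume "z \<in> S" "g \<in> nb z - {sp z}"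
    then have "g \<in> S \<or> g \<in> W" "\<not> (g \<in> S \<and> g \<in> W)"
      using nb[of z] fin(3) by auto
    then show "(if g \<in> W then k z else 0) + h (sp z) g = 2"
      by (auto simp: k_def h_def)
  qed
  also have "\<dots> = (\<Sum>z\<in>S. 4)"
  proof (intro sum.cong refl)
    show "(\<Sum>g\<in>nb z - {sp z}. 2) = (4 :: nat)" if "z \<in> S" for z
      using slots[of z "sp z"] that by (simp add: U_def)
  qed
  finally have total: "(\<Sum>w\<in>W. inc w + out w) = 4 * card S"
    by simp
  have "28 * card (S \<union> W) = 24 * card S + (4 * card S + 28 * card W)"
    using fin by (simp add: card_Un_disjoint)
  also have "4 * card S + 28 * card W = (\<Sum>w\<in>W. inc w + out w + 28)"
    by (simp add: sum.distrib flip: total)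
  also have "\<dots> \<le> (\<Sum>w\<in>W. 8 * card (nb w))"
    by (intro sum_mono bound)
  also have "24 * card S = (\<Sum>z\<in>S. 8 * card (nb z))"
    using S(1) by simp
  also have "\<dots> + (\<Sum>w\<in>W. 8 * card (nb w)) = (\<Sum>v\<in>S \<union> W. 8 * card (nb v))"
    using fin by (intro sum.union_disjoint[symmetric])
  finally show ?thesis
    by (simp add: sum_distrib_left)
qed

section \<open>Vertices of degree three\<close>

definition deg3 :: "'a rel \<Rightarrow> 'a set \<Rightarrow> 'a set" where
  "deg3 E A = {v \<in> A. card (nb E A v) = 3}"

text \<open>For degree 3 in a critical digraph, in-degree and out-degree are 1 and 2 in some order,
  so \<open>the_elem\<close> is applied to a singleton.\<close>

definition supp :: "'a rel \<Rightarrow> 'a set \<Rightarrow> 'a \<Rightarrow> 'a" where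
  "supp E A v = the_elem (if card (preds E A v) = 1 then preds E A v else succs E A v)"

definition thick :: "'a rel \<Rightarrow> 'a set \<Rightarrow> 'a \<Rightarrow> bool" where
  "thick E A x \<longleftrightarrow> (\<exists>z\<in>deg3 E A. \<exists>z'\<in>deg3 E A. z \<noteq> z' \<and> supp E A z = x \<and> supp E A z' = x \<and>
     ({z, z'} \<subseteq> preds E A x \<or> {z, z'} \<subseteq> succs E A x))"

lemma deg3_cases:
  assumes crit: "critical E A" and z: "z \<in> deg3 E A"
  obtains (single_pred) "preds E A z = {supp E A z}" "card (succs E A z) = 2"
    | (single_succ) "succs E A z = {supp E A z}" "card (preds E A z) = 2"
proof -
  have A: "finite A" "asym E" "z \<in> A"
    using crit z by (auto simp: critical_def deg3_def)
  have "card (preds E A z) \<noteq> 0" "card (succs E A z) \<noteq> 0"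
    using critical_preds_nonempty[OF crit A(3)] critical_succs_nonempty[OF crit A(3)]
      finite_preds[OF A(1)] finite_succs[OF A(1)] by auto
  moreover have sum: "card (preds E A z) + card (succs E A z) = 3"
    using z card_nb[OF A(1,2)] by (simp add: deg3_def)
  ultimately consider "card (preds E A z) = 1" "card (succs E A z) = 2"
    | "card (preds E A z) = 2" "card (succs E A z) = 1"
    by linarith
  then show thesis
  proof cases
    case 1
    obtain p where "preds E A z = {p}"
      using card_1_singletonE[OF 1(1)] by blast
    then have "preds E A z = {supp E A z}"
      by (simp add: supp_def)
    then show ?thesis
      using 1 that by blast
  next
    case 2
    obtain p where "succs E A z = {p}"
      using card_1_singletonE[OF 2(2)] by blast
    then have "succs E A z = {supp E A z}"
      using 2 by (simp add: supp_def)
    then show ?thesis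
      using 2 that by blast
  qed
qed

lemma supp_nb:
  assumes crit: "critical E A" and z: "z \<in> deg3 E A"
  shows "supp E A z \<in> A - deg3 E A" "supp E A z \<in> nb E A z"
proof -
  have zA: "z \<in> A"
    using z by (auto simp: deg3_def)
  from crit z show "supp E A z \<in> nb E A z"
    by (cases rule: deg3_cases) (auto simp: nb_def)
  then have "supp E A z \<in> A"
    by (auto simp: nb_def preds_def succs_def)
  moreover from crit z have "card (nb E A (supp E A z)) \<noteq> 3"
  proof (cases rule: deg3_cases)
    case single_pred
    then show ?thesis
      by (intro critical_pred_degree[OF crit zA])
  next
    case single_succ
    then show ?thesis
      by (intro critical_succ_degree[OF crit zA])
  qed
  ultimately show "supp E A z \<in> A - deg3 E A"
    by (auto simp: deg3_def)
qed

lemma supported_deg3: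
  assumes crit: "critical E A"
  shows "supported E A (deg3 E A) (supp E A)"
  unfolding supported_def
proof (intro conjI ballI)
  show "finite (deg3 E A)" "deg3 E A \<subseteq> A"
    using crit by (auto simp: deg3_def critical_def)
  fix z assume z: "z \<in> deg3 E A"
  show "supp E A z \<in> A - deg3 E A"
    using supp_nb[OF crit z] by blast
  show "(\<forall>y\<in>A. (y, z) \<in> E \<longrightarrow> y = supp E A z) \<or> (\<forall>y\<in>A. (z, y) \<in> E \<longrightarrow> y = supp E A z)"
    using crit z by (cases rule: deg3_cases) (auto simp: preds_def succs_def set_eq_iff)
qed

text \<open>All neighbours of \<open>z\<close> except its supporter are alive while the supporter is
  recoloured. For a vertex of degree 3 this means having the same supporter.\<close>

lemma deg3_partner:
  assumes crit: "critical E A" and z: "z \<in> deg3 E A" and g: "g \<in> nb E A z" "g \<in> deg3 E A"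
  shows "supp E A g = supp E A z"
proof -
  have "g \<noteq> supp E A z"
    using supp_nb(1)[OF crit z] g by auto
  from crit z have "g \<in> alive A (deg3 E A) (supp E A) (supp E A z)"
  proof (cases rule: deg3_cases)
    case single_pred
    then have "g \<in> succs E A z"
      using g \<open>g \<noteq> supp E A z\<close> by (auto simp: nb_def)
    then show ?thesis
      using critical_succs_alive[OF crit supported_deg3[OF crit] z single_pred] by blast
  next
    case single_succ
    then have "g \<in> preds E A z"
      using g \<open>g \<noteq> supp E A z\<close> by (auto simp: nb_def)
    then show ?thesis
      using critical_preds_alive[OF crit supported_deg3[OF crit] z single_succ] by blast
  qed
  then show ?thesis
    using g by (auto simp: alive_def)
qed

text \<open>Two supported vertices on the same side of \<open>x\<close> both have \<open>x\<close>
  as their only in-neighbour, or both as their only out-neighbour. An arc between them would give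
  one of them a second one.\<close>

lemma thick_nonadjacent:
  assumes crit: "critical E A" and "thick E A x"
  shows "\<exists>z\<in>deg3 E A. \<exists>z'\<in>deg3 E A. z \<noteq> z' \<and> supp E A z = x \<and> supp E A z' = x \<and> z' \<notin> nb E A z"
proof -
  obtain z z' where z: "z \<in> deg3 E A" "z' \<in> deg3 E A" "z \<noteq> z'" "supp E A z = x" "supp E A z' = x"
    and side: "{z, z'} \<subseteq> preds E A x \<or> {z, z'} \<subseteq> succs E A x"
    using assms(2) by (auto simp: thick_def)
  have asym: "(b, a) \<notin> E" if "(a, b) \<in> E" for a b
    using crit that by (auto simp: critical_def dest: asymD)
  have only: "a \<notin> nb E A b" if "{a, b} \<subseteq> deg3 E A" "supp E A a = x" "supp E A b = x" "a \<noteq> b"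
    "{a, b} \<subseteq> preds E A x \<or> {a, b} \<subseteq> succs E A x" for a b
  proof -
    have "x \<notin> deg3 E A"
      using supp_nb[OF crit, of a] that by auto
    moreover have "preds E A v = {x}" if "v \<in> {a, b}" "{a, b} \<subseteq> succs E A x" for v
    proof -
      have "v \<in> deg3 E A" "supp E A v = x" "v \<in> succs E A x"
        using that \<open>{a, b} \<subseteq> deg3 E A\<close> \<open>supp E A a = x\<close> \<open>supp E A b = x\<close> by auto
      moreover have "x \<notin> succs E A v"
        using \<open>v \<in> succs E A x\<close> asym by (auto simp: succs_def)
      ultimately show ?thesis
        using deg3_cases[OF crit, of v] by (metis singletonI)
    qed
    moreover have "succs E A v = {x}" if "v \<in> {a, b}" "{a, b} \<subseteq> preds E A x" for v
    proof -
      have "v \<in> deg3 E A" "supp E A v = x" "v \<in> preds E A x"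
        using that \<open>{a, b} \<subseteq> deg3 E A\<close> \<open>supp E A a = x\<close> \<open>supp E A b = x\<close> by auto
      moreover have "x \<notin> preds E A v"
        using \<open>v \<in> preds E A x\<close> asym by (auto simp: preds_def)
      ultimately show ?thesis
        using deg3_cases[OF crit, of v] by (metis singletonI)
    qed
    moreover have "b \<in> preds E A a" if "a \<in> succs E A b" "{a, b} \<subseteq> A"
      using that by (auto simp: preds_def succs_def)
    moreover have "b \<in> succs E A a" if "a \<in> preds E A b" "{a, b} \<subseteq> A"
      using that by (auto simp: preds_def succs_def)
    moreover have "{a, b} \<subseteq> A"
      using that(1) by (auto simp: deg3_def)
    ultimately show ?thesis
      using that unfolding nb_def by (metis UnE insert_subset insertCI singletonD)
  qed
  then show ?thesis
    using z side by (metis empty_subsetI insert_commute insert_subset)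
qed

text \<open>The case \<open>f = x\<close>, exempt in the third hypothesis, leaves \<open>P\<close>
  empty and hence inside \<open>{u}\<close>.\<close>

lemma card_ge_2I:
  assumes "finite P" "x \<notin> P" "\<And>f. f \<noteq> x \<Longrightarrow> \<not> P \<subseteq> {f}" "u \<noteq> x"
  shows "2 \<le> card P"
proof (rule ccontr)
  assume "\<not> 2 \<le> card P"
  then have "card P < 2"
    by simp
  then obtain f where f: "P \<subseteq> {f}"
    using card_le_1E[OF assms(1)] by blast
  then have "f = x"
    using assms(3) by blast
  then have "P \<subseteq> {u}"
    using f assms(2) by blast
  then show False
    using assms(3,4) by blast
qed

text \<open>If no \<open>x\<close> blocked it, \<open>mix_delete_free\<close> would delete
  \<open>u\<close>. A blocking \<open>x\<close> supports at least two neighbours of \<open>u\<close>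
  on each side that misses the high-degree neighbour \<open>t\<close>; these also lie on one side of
  \<open>x\<close>, which makes \<open>x\<close> thick. Without such a \<open>t\<close> both sides
  contribute two.\<close>

lemma critical_few_high_neighbours:
  assumes crit: "critical E A" and u: "u \<in> A - deg3 E A"
    and few: "card (nb E A u \<inter> (A - deg3 E A)) \<le> 1"
  shows "\<exists>x\<in>A - deg3 E A - {u}. thick E A x \<and>
    2 \<le> card (nb E A u \<inter> {z \<in> deg3 E A. supp E A z = x}) \<and>
    (nb E A u \<inter> (A - deg3 E A) = {} \<longrightarrow> 4 \<le> card (nb E A u \<inter> {z \<in> deg3 E A. supp E A z = x}))"
proof -
  let ?S = "deg3 E A" and ?sp = "supp E A"
  let ?L = "alive A ?S ?sp" and ?P = "preds E A u" and ?Q = "succs E A u"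
  have A: "finite A" "asym E" "\<exists>c. good E A c" "\<not> mix E A"
    using crit by (auto simp: critical_def)
  have fin: "finite ?P" "finite ?Q"
    by (rule finite_preds[OF A(1)], rule finite_succs[OF A(1)])
  have disj: "?P \<inter> ?Q = {}"
    by (rule preds_succs_disjoint[OF A(2)])
  obtain t where t: "nb E A u \<inter> (A - ?S) \<subseteq> {t}"
    using card_le_1E[of "nb E A u \<inter> (A - ?S)"] few A(1) by auto
  have t': "y = t" if "y \<in> A - ?S" "(y, u) \<in> E \<or> (u, y) \<in> E" for y
  proof -
    have "y \<in> nb E A u \<inter> (A - ?S)"
      using that by (auto simp: nb_def preds_def succs_def)
    then show ?thesis
      using t by blast
  qed
  have "A - insert u {v \<in> ?S. ?sp v = u} \<subset> A"
    using u by blast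
  then have "mix E (A - insert u {v \<in> ?S. ?sp v = u})"
    using crit unfolding critical_def by blast
  note mix_B = this
  have "\<exists>x\<in>A - ?S - {u}. \<forall>f. f \<noteq> x \<longrightarrow>
      \<not> (\<forall>y\<in>?L x. (y, u) \<in> E \<longrightarrow> y = f) \<and> \<not> (\<forall>y\<in>?L x. (u, y) \<in> E \<longrightarrow> y = f)"
  proof (rule ccontr)
    assume ctr: "\<not> ?thesis"
    have "mix E A"
    proof (rule mix_delete_free[OF supported_deg3[OF crit] A(2) u _ _ mix_B A(3)])
      show "y = t" if "y \<in> A - ?S" "(y, u) \<in> E \<or> (u, y) \<in> E" for y
        using that by (rule t')
      show "\<exists>f. f \<noteq> x \<and>
          ((\<forall>y\<in>?L x. (y, u) \<in> E \<longrightarrow> y = f) \<or> (\<forall>y\<in>?L x. (u, y) \<in> E \<longrightarrow> y = f))"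
        if "x \<in> A - ?S - {u}" for x
        using ctr that by blast
    qed
    then show False
      using A(4) by blast
  qed
  then obtain x where x: "x \<in> A - ?S - {u}"
    and no': "\<And>f. f \<noteq> x \<Longrightarrow> \<not> (\<forall>y\<in>?L x. (y, u) \<in> E \<longrightarrow> y = f)"
      "\<And>f. f \<noteq> x \<Longrightarrow> \<not> (\<forall>y\<in>?L x. (u, y) \<in> E \<longrightarrow> y = f)"
    by blast
  have LA: "?L x \<subseteq> A"
    by (auto simp: alive_def)
  have no: "\<not> ?P \<inter> ?L x \<subseteq> {f}" "\<not> ?Q \<inter> ?L x \<subseteq> {f}" if "f \<noteq> x" for f
    using no'[OF that] LA unfolding preds_def succs_def by blast+
  let ?U = "{z \<in> ?S. ?sp z = x}"
  have L: "?L x = (A - ?S) \<union> ?U"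
    using u by (auto simp: alive_def deg3_def)
  have side: "2 \<le> card (R \<inter> ?U)" if "R \<inter> ?L x \<subseteq> ?U" "\<And>f. f \<noteq> x \<Longrightarrow> \<not> R \<inter> ?L x \<subseteq> {f}" "finite R" for R
  proof -
    have "R \<inter> ?L x = R \<inter> ?U"
      using that(1) L by auto
    then have "2 \<le> card (R \<inter> ?L x)"
      using that(2,3) x by (intro card_ge_2I[of _ x u]) auto
    then show ?thesis
      using \<open>R \<inter> ?L x = R \<inter> ?U\<close> by simp
  qed
  have outside: "R \<inter> ?L x \<subseteq> ?U" if "t \<notin> R" "R \<subseteq> nb E A u" for R
    using that t L by auto
  have nbU: "card (R \<inter> ?U) \<le> card (nb E A u \<inter> ?U)" if "R \<subseteq> nb E A u" for R
    using that A(1) by (intro card_mono) (auto simp: deg3_def)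
  have thick: "thick E A x" if R: "2 \<le> card (R \<inter> ?U)" "R = ?P \<or> R = ?Q" for R
  proof -
    obtain z z' where zz: "z \<noteq> z'" "z \<in> R" "z' \<in> R" "z \<in> ?U" "z' \<in> ?U"
    proof -
      have "R \<inter> ?U \<noteq> {}"
        using R(1) by (metis card.empty not_numeral_le_zero)
      then obtain z where "z \<in> R \<inter> ?U"
        by blast
      moreover have "\<not> R \<inter> ?U \<subseteq> {z}"
        using R(1) card_mono[of "{z}" "R \<inter> ?U"] by auto
      ultimately show thesis
        using that by blast
    qed
    have "x \<noteq> u"
      using x by blast
    \<comment> \<open>\<open>v\<close> has the out-neighbour \<open>u\<close> different from
      \<open>x\<close>, so its supporter \<open>x\<close> must be its only in-neighbour.\<close>
    have P: "v \<in> succs E A x" if "v \<in> ?P" "v \<in> ?U" for v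
    proof -
      have "u \<in> succs E A v" "v \<in> deg3 E A" "supp E A v = x" "v \<in> A"
        using that u by (auto simp: preds_def succs_def)
      then have "x \<in> preds E A v"
        using deg3_cases[OF crit, of v] \<open>x \<noteq> u\<close> by (metis singletonD singletonI)
      then show ?thesis
        using \<open>v \<in> A\<close> by (auto simp: preds_def succs_def)
    qed
    have Q: "v \<in> preds E A x" if "v \<in> ?Q" "v \<in> ?U" for v
    proof -
      have "u \<in> preds E A v" "v \<in> deg3 E A" "supp E A v = x" "v \<in> A"
        using that u by (auto simp: preds_def succs_def)
      then have "x \<in> succs E A v"
        using deg3_cases[OF crit, of v] \<open>x \<noteq> u\<close> by (metis singletonD singletonI)
      then show ?thesis
        using \<open>v \<in> A\<close> by (auto simp: preds_def succs_def)
    qed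
    have "{z, z'} \<subseteq> preds E A x \<or> {z, z'} \<subseteq> succs E A x"
      using R(2) zz P Q by blast
    then show ?thesis
      using zz unfolding thick_def by blast
  qed
  have sides: "2 \<le> card (?P \<inter> ?U)" if "t \<notin> ?P"
    using side[OF outside[OF that] no(1) fin(1)] by (simp add: nb_def)
  have sides': "2 \<le> card (?Q \<inter> ?U)" if "t \<notin> ?Q"
    using side[OF outside[OF that] no(2) fin(2)] by (simp add: nb_def)
  have "t \<notin> ?P \<or> t \<notin> ?Q"
    using disj by blast
  then have "thick E A x" "2 \<le> card (nb E A u \<inter> ?U)"
    using sides sides' thick nbU[of ?P] nbU[of ?Q] by (auto simp: nb_def)
  moreover have "4 \<le> card (nb E A u \<inter> ?U)" if none: "nb E A u \<inter> (A - ?S) = {}"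
  proof -
    have "R \<inter> ?L x \<subseteq> ?U" if "R \<subseteq> nb E A u" for R
      using that none L by auto
    then have "2 \<le> card (?P \<inter> ?U)" "2 \<le> card (?Q \<inter> ?U)"
      using side[OF _ no(1) fin(1)] side[OF _ no(2) fin(2)] by (auto simp: nb_def)
    moreover have "card (nb E A u \<inter> ?U) = card (?P \<inter> ?U) + card (?Q \<inter> ?U)"
      unfolding nb_def Int_Un_distrib2 using fin disj by (intro card_Un_disjoint) auto
    ultimately show ?thesis
      by linarith
  qed
  ultimately show ?thesis
    using x by blast
qed

section \<open>Arc counts and the choice of a minimal set\<close>

abbreviation arcs_in :: "'a rel \<Rightarrow> 'a set \<Rightarrow> 'a rel" where
  "arcs_in E A \<equiv> {(x, y) \<in> E. x \<in> A \<and> y \<in> A}"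

lemma card_arcs_in:
  assumes "finite A"
  shows "card (arcs_in E A) = (\<Sum>v\<in>A. card (succs E A v))"
    "card (arcs_in E A) = (\<Sum>v\<in>A. card (preds E A v))"
proof -
  have card: "card (arcs_in E A) = (\<Sum>v\<in>A. card (succs E A v))" for E
  proof -
    have "arcs_in E A = Sigma A (succs E A)"
      by (auto simp: succs_def)
    then show ?thesis
      using assms finite_succs[OF assms] by simp
  qed
  then show "card (arcs_in E A) = (\<Sum>v\<in>A. card (succs E A v))" .
  have "arcs_in (E\<inverse>) A = (arcs_in E A)\<inverse>"
    by auto
  then show "card (arcs_in E A) = (\<Sum>v\<in>A. card (preds E A v))"
    using card[of "E\<inverse>"] card_inverse[of "arcs_in E A"] unfolding succs_converse by presburger
qed

lemma critical_dense:
  assumes crit: "critical E A"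
  shows "7 * card A \<le> 4 * card (arcs_in E A)"
proof -
  let ?S = "deg3 E A" and ?W = "A - deg3 E A"
  have A: "finite A" "asym E"
    using crit by (auto simp: critical_def)
  have SW: "?S \<union> ?W = A" and "?S \<subseteq> A"
    by (auto simp: deg3_def)
  have "28 * card (?S \<union> ?W) \<le> 8 * (\<Sum>v\<in>?S \<union> ?W. card (nb E A v))"
  proof (rule discharging[where sp="supp E A" and thick="thick E A"])
    show "finite ?S" "finite ?W" "?S \<inter> ?W = {}"
      using A by (auto simp: deg3_def)
    show "nb E A v \<subseteq> ?S \<union> ?W - {v}" for v
      using asymD[OF A(2), of v v] unfolding SW by (auto simp: nb_def preds_def succs_def)
    show "v \<in> nb E A w" if "v \<in> ?S \<union> ?W" "w \<in> nb E A v" for v w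
      using that by (auto simp: nb_def preds_def succs_def deg3_def)
    show "card (nb E A z) = 3" if "z \<in> ?S" for z
      using that by (simp add: deg3_def)
    show "supp E A z \<in> ?W \<inter> nb E A z" if "z \<in> ?S" for z
      using supp_nb[OF crit that] by blast
    show "4 \<le> card (nb E A w)" if "w \<in> ?W" for w
      using critical_degree[OF crit, of w] that by (auto simp: deg3_def)
    show "supp E A g = supp E A z" if "z \<in> ?S" "g \<in> nb E A z" "g \<in> ?S" for z g
      using deg3_partner[OF crit] that by blast
    show "\<exists>z\<in>?S. \<exists>z'\<in>?S. z \<noteq> z' \<and> supp E A z = w \<and> supp E A z' = w \<and> z' \<notin> nb E A z"
      if "thick E A w" for w
      using thick_nonadjacent[OF crit that] .
    show "\<exists>x\<in>?W - {u}. thick E A x \<and>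
      2 \<le> card (nb E A u \<inter> {z \<in> ?S. supp E A z = x}) \<and>
      (nb E A u \<inter> ?W = {} \<longrightarrow> 4 \<le> card (nb E A u \<inter> {z \<in> ?S. supp E A z = x}))"
      if "u \<in> ?W" "card (nb E A u \<inter> ?W) \<le> 1" for u
      using critical_few_high_neighbours[OF crit that] .
  qed
  also have "(\<Sum>v\<in>?S \<union> ?W. card (nb E A v)) = 2 * card (arcs_in E A)"
    unfolding SW card_nb[OF A] sum.distrib
    by (simp only: card_arcs_in[OF A(1), of E, symmetric] mult_2)
  finally show ?thesis
    unfolding SW by simp
qed

text \<open>A vertex with at most one in-neighbour could be put back into a good colouring of the
  rest, coloured unlike that in-neighbour. So all in-degrees are at least 2.\<close>

lemma uncolourable_dense:
  assumes "finite A" "asym E" "\<nexists>c. good E A c" "\<And>B. B \<subset> A \<Longrightarrow> mix E B"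
  shows "2 * card A \<le> card (arcs_in E A)"
proof -
  have "2 \<le> card (preds E A v)" if v: "v \<in> A" for v
  proof (rule ccontr)
    assume "\<not> 2 \<le> card (preds E A v)"
    then obtain f where f: "preds E A v \<subseteq> {f}"
      using card_le_1E[OF finite_preds[OF assms(1)]] by (metis not_less)
    have "A - {v} \<subset> A"
      using v by blast
    then have "mix E (A - {v})"
      by (rule assms(4))
    then obtain c where c: "good E (A - {v}) c"
      unfolding mix_def by blast
    let ?c = "c(v := \<not> c f)"
    have "good E A ?c"
    proof (rule good_remove[where D="{v}"])
      show "good E (A - {v}) ?c"
        by (rule good_cong_subset[OF c]) auto
      have "?c y \<noteq> ?c v" if "y \<in> A" "(y, v) \<in> E" for y
      proof -
        have "y = f" "y \<noteq> v"
          using f that asymD[OF assms(2), of v v] by (auto simp: preds_def)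
        then show ?thesis
          by simp
      qed
      then show "(\<forall>y\<in>A. (y, z) \<in> E \<longrightarrow> ?c y \<noteq> ?c z) \<or> (\<forall>y\<in>A. (z, y) \<in> E \<longrightarrow> ?c y \<noteq> ?c z)"
        if "z \<in> {v}" for z
        using that by blast
    qed
    then show False
      using assms(3) by blast
  qed
  then have "(\<Sum>v\<in>A. 2) \<le> (\<Sum>v\<in>A. card (preds E A v))"
    by (intro sum_mono)
  then show ?thesis
    by (simp add: card_arcs_in(2)[OF assms(1), of E] mult.commute)
qed

lemma dense_if_not_mix:
  assumes "finite A" "asym E" "\<not> mix E A"
  obtains B where "B \<subseteq> A" "B \<noteq> {}" "7 * card B \<le> 4 * card (arcs_in E B)"
proof -
  have "\<exists>B. B \<subseteq> A \<and> \<not> mix E B \<and> (\<forall>C. C \<subset> B \<longrightarrow> mix E C)"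
    using assms(1,3)
  proof (induction A rule: finite_psubset_induct)
    case (psubset A)
    show ?case
    proof (cases "\<forall>C. C \<subset> A \<longrightarrow> mix E C")
      case True
      then show ?thesis
        using psubset.prems by blast
    next
      case False
      then obtain C where C: "C \<subset> A" "\<not> mix E C"
        by blast
      show ?thesis
        using psubset.IH[OF C] C(1) by (meson order_trans psubset_imp_subset)
    qed
  qed
  then obtain B where B: "B \<subseteq> A" "\<not> mix E B" "\<And>C. C \<subset> B \<Longrightarrow> mix E C"
    by blast
  have "finite B"
    using B(1) assms(1) finite_subset by blast
  \<comment> \<open>The empty set satisfies the density bound trivially and gives no average degree,
    so it must be ruled out as the minimal set.\<close>
  have "mix E {}"
    unfolding mix_def
  proof (intro conjI allI impI exI)
    show "good E {} (\<lambda>_. True)"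
      by (simp add: good_def mono_arcs_def acyclic_def)
    show "linked E {} c c'" if "good E {} c" for c c'
      using that by (rule adj_agree) simp
  qed
  then have "B \<noteq> {}"
    using B(2) by blast
  have "7 * card B \<le> 4 * card (arcs_in E B)"
  proof (cases "\<exists>c. good E B c")
    case True
    then have "critical E B"
      using B \<open>finite B\<close> assms(2) by (simp add: critical_def)
    then show ?thesis
      by (rule critical_dense)
  next
    case False
    then have "2 * card B \<le> card (arcs_in E B)"
      using uncolourable_dense \<open>finite B\<close> assms(2) B(3) by blast
    then show ?thesis
      by linarith
  qed
  then show thesis
    using that B(1) \<open>B \<noteq> {}\<close> by blast
qed

section \<open>Dicolourings and the maximum average degree\<close>

context wf_digraph
begin

definition mono_subgraph :: "('a \<Rightarrow> 'c) \<Rightarrow> ('a, 'b) pre_digraph" where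
  "mono_subgraph c = G\<lparr>arcs := {e \<in> arcs G. c (tail G e) = c (head G e)}\<rparr>"

lemma wf_mono_subgraph: "wf_digraph (mono_subgraph c)"
  by unfold_locales (auto simp: mono_subgraph_def)

lemma arcs_ends_mono_subgraph: "arcs_ends (mono_subgraph c) = mono_arcs (arcs_ends G) (verts G) c"
  by (auto simp: mono_subgraph_def mono_arcs_def arcs_ends_def arc_to_ends_def)

lemma mono_subgraph_simps [simp]:
  "verts (mono_subgraph c) = verts G" "tail (mono_subgraph c) = tail G"
  "head (mono_subgraph c) = head G"
  "arcs (mono_subgraph c) = {e \<in> arcs G. c (tail G e) = c (head G e)}"
  by (simp_all add: mono_subgraph_def)

lemma cas_mono_subgraph: "pre_digraph.cas (mono_subgraph c) u p v = cas u p v"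
  by (induction p arbitrary: u) (simp_all add: pre_digraph.cas.simps)

lemma monochromatic_cycle_iff:
  "(\<exists>p i. cycle p \<and> (\<forall>e\<in>set p. c (tail G e) = i)) \<longleftrightarrow> \<not> acyclic (mono_arcs (arcs_ends G) (verts G) c)"
proof
  let ?H = "mono_subgraph c"
  interpret H: wf_digraph ?H
    by (rule wf_mono_subgraph)
  {
    assume "\<exists>p i. cycle p \<and> (\<forall>e\<in>set p. c (tail G e) = i)"
    then obtain p i u where p: "awalk u p u" "p \<noteq> []" and tails: "\<forall>e\<in>set p. c (tail G e) = i"
      by (auto simp: cycle_def)
    \<comment> \<open>The hypothesis speaks of tails only. The head of an arc is the tail of the
      next one, or the end of the walk for the last arc.\<close>
    have heads: "\<forall>e\<in>set p. c (head G e) = i" if "cas w p v" "c v = i" "\<forall>e\<in>set p. c (tail G e) = i" for w v p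
      using that
    proof (induction p arbitrary: w)
      case (Cons e p)
      then have "\<forall>e\<in>set p. c (head G e) = i"
        by auto
      moreover have "c (head G e) = i"
        using Cons.prems by (cases p) auto
      ultimately show ?case
        by simp
    qed simp
    have "c u = i"
      using p tails by (cases p) (auto simp: awalk_def)
    then have "\<forall>e\<in>set p. c (head G e) = i"
      using heads[of u p u] p tails by (auto simp: awalk_def)
    then have "H.awalk u p u"
      using p tails by (auto simp: H.awalk_def awalk_def cas_mono_subgraph)
    then have "(u, u) \<in> (arcs_ends ?H)\<^sup>+"
      using p(2) H.reachable1_awalk by blast
    then show "\<not> acyclic (mono_arcs (arcs_ends G) (verts G) c)"
      unfolding arcs_ends_mono_subgraph acyclic_def by blast
  }
  {
    assume "\<not> acyclic (mono_arcs (arcs_ends G) (verts G) c)"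
    then obtain u where "(u, u) \<in> (arcs_ends ?H)\<^sup>+"
      unfolding arcs_ends_mono_subgraph acyclic_def by blast
    then obtain q where "H.awalk u q u" "q \<noteq> []"
      using H.reachable1_awalk by blast
    then have "H.closed_w q"
      by (auto simp: H.closed_w_def)
    then obtain p where "H.cycle p"
      using H.closed_w_imp_cycle by blast
    then obtain v where p: "H.awalk v p v"
      by (auto simp: H.cycle_def)
    have "\<forall>e\<in>set p. c (tail G e) = c v" if "cas v p w" "set p \<subseteq> arcs ?H" for v w p
      using that by (induction p arbitrary: v) auto
    then have "\<forall>e\<in>set p. c (tail G e) = c v"
      using p by (auto simp: H.awalk_def cas_mono_subgraph)
    moreover have "subgraph ?H G"
      using wf_mono_subgraph wf_digraph_axioms by (auto simp: subgraph_def compatible_def)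
    then have "cycle p"
      using subgraph_cycle \<open>H.cycle p\<close> by blast
    ultimately show "\<exists>p i. cycle p \<and> (\<forall>e\<in>set p. c (tail G e) = i)"
      by blast
  }
qed

definition colouring :: "('a \<Rightarrow> bool) \<Rightarrow> 'a \<Rightarrow> nat" where
  "colouring c = restrict (\<lambda>v. if c v then 2 else 1) (verts G)"

lemma dicolouring_2_iff:
  "dicolouring G 2 d \<longleftrightarrow> (\<exists>c. d = colouring c \<and> good (arcs_ends G) (verts G) c)"
proof -
  have good: "good (arcs_ends G) (verts G) c \<longleftrightarrow>
      \<not> (\<exists>p i. cycle p \<and> (\<forall>e\<in>set p. colouring c (tail G e) = i))" for c
  proof -
    have "mono_arcs (arcs_ends G) (verts G) (colouring c) = mono_arcs (arcs_ends G) (verts G) c"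
      by (auto simp: mono_arcs_def colouring_def split: if_splits)
    then show ?thesis
      unfolding monochromatic_cycle_iff good_def by simp
  qed
  have PiE: "d \<in> PiE (verts G) (\<lambda>_. {1..2}) \<longleftrightarrow> (\<exists>c. d = colouring c)" for d
  proof
    assume d: "d \<in> PiE (verts G) (\<lambda>_. {1..2})"
    have "d v = colouring (\<lambda>v. d v = 2) v" for v
    proof (cases "v \<in> verts G")
      case True
      then have "d v \<in> {1..2}"
        using d by blast
      then show ?thesis
        using True by (auto simp: colouring_def)
    next
      case False
      then show ?thesis
        using d by (auto simp: colouring_def)
    qed
    then show "\<exists>c. d = colouring c"
      by blast
  qed (auto simp: colouring_def)
  show ?thesis
    unfolding dicolouring_def PiE using good by blast
qed

lemma mixing_2I:
  assumes "mix (arcs_ends G) (verts G)"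
  shows "mixing 2 G"
proof -
  let ?E = "arcs_ends G" and ?A = "verts G" and ?D = "dicolouring_graph G 2"
  let ?R = "rtrancl_on (pverts ?D) (parcs ?D)"
  have step: "(colouring c, colouring c') \<in> ?R" if adj: "adj ?E ?A c c'" for c c'
  proof (cases "colouring c = colouring c'")
    \<comment> \<open>\<open>adj\<close> allows equal colourings and differences outside the vertex
      set, while an arc of \<open>dicolouring_graph\<close> needs a real difference; here the path
      is trivial.\<close>
    case True
    then show ?thesis
      using adj by (auto simp: adj_def dicolouring_graph_def dicolouring_2_iff intro: rtrancl_on_refl)
  next
    case False
    obtain x where x: "\<And>y. y \<in> ?A \<Longrightarrow> y \<noteq> x \<Longrightarrow> c y = c' y"
      using adj by (auto simp: adj_def)
    have sub: "{v \<in> ?A. colouring c v \<noteq> colouring c' v} \<subseteq> {x}"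
      using x by (auto simp: colouring_def)
    moreover have "{v \<in> ?A. colouring c v \<noteq> colouring c' v} \<noteq> {}"
      using False by (auto simp: colouring_def fun_eq_iff restrict_def split: if_splits)
    ultimately have "{v \<in> ?A. colouring c v \<noteq> colouring c' v} = {x}"
      by blast
    then have "card {v \<in> ?A. colouring c v \<noteq> colouring c' v} = 1"
      by simp
    moreover have "dicolouring G 2 (colouring c)" "dicolouring G 2 (colouring c')"
      using adj by (auto simp: adj_def dicolouring_2_iff)
    ultimately show ?thesis
      by (intro rtrancl_on_into_rtrancl_on[OF rtrancl_on_refl]) (auto simp: dicolouring_graph_def)
  qed
  \<comment> \<open>\<open>linked\<close> is reflexive even at colourings that are not good,
    \<open>rtrancl_on\<close> only at vertices; hence the assumption on \<open>c\<close>.\<close>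
  have path: "(colouring c, colouring c') \<in> ?R" if "good ?E ?A c" "linked ?E ?A c c'" for c c'
    using that(2)
  proof (induction rule: rtranclp_induct)
    case base
    then show ?case
      using that(1) by (auto simp: dicolouring_graph_def dicolouring_2_iff intro: rtrancl_on_refl)
  next
    case (step c' c'')
    then show ?case
      using \<open>\<And>c c'. adj ?E ?A c c' \<Longrightarrow> (colouring c, colouring c') \<in> ?R\<close> rtrancl_on_trans by metis
  qed
  show ?thesis
    unfolding mixing_def Digraph_Component.connected_def
  proof (rule strongly_connectedI)
    show "verts (with_proj (mk_symmetric (with_proj ?D))) \<noteq> {}"
      using assms by (auto simp: mix_def dicolouring_graph_def dicolouring_2_iff)
    fix d d'
    assume "d \<in> verts (with_proj (mk_symmetric (with_proj ?D)))"
      "d' \<in> verts (with_proj (mk_symmetric (with_proj ?D)))"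
    then have "dicolouring G 2 d" "dicolouring G 2 d'"
      by (auto simp: dicolouring_graph_def)
    then obtain c c' where "d = colouring c" "d' = colouring c'" "good ?E ?A c" "good ?E ?A c'"
      by (auto simp: dicolouring_2_iff)
    then have "(d, d') \<in> ?R"
      using path assms by (auto simp: mix_def)
    moreover have "parcs ?D \<subseteq> parcs (mk_symmetric (with_proj ?D))"
      by (auto simp: parcs_mk_symmetric)
    ultimately show "d \<rightarrow>\<^sup>*\<^bsub>with_proj (mk_symmetric (with_proj ?D))\<^esub> d'"
      unfolding reachable_def by (auto intro: rtrancl_on_mono)
  qed
qed

end

section \<open>From arc counts to \<open>Mad\<close>\<close>

lemma (in digraph) card_arcs_induce_subgraph:
  "card (arcs (G \<restriction> B)) = card (arcs_in (arcs_ends G) B)"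
proof -
  have "arc_to_ends G ` arcs (G \<restriction> B) = arcs_in (arcs_ends G) B"
    by (auto simp: arcs_ends_def arc_to_ends_def)
  moreover have "inj_on (arc_to_ends G) (arcs (G \<restriction> B))"
    using no_multi_arcs by (auto simp: inj_on_def)
  ultimately show ?thesis
    by (metis card_image)
qed

text \<open>The quotient depends only on the arc set and the vertex set of \<open>H\<close>, each a
  subset of a finite set, so the maximum is taken over a finite set.\<close>

lemma (in fin_digraph) Mad_ge:
  assumes "subgraph H G" "verts H \<noteq> {}"
  shows "2 * real (card (arcs H)) / real (card (verts H)) \<le> Mad G"
proof -
  let ?M = "{2 * real (card (arcs H)) / real (card (verts H)) | H. subgraph H G \<and> verts H \<noteq> {}}"
  have "?M \<subseteq> (\<lambda>(B, V). 2 * real (card B) / real (card V)) ` (Pow (arcs G) \<times> Pow (verts G))"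
    by (auto simp: subgraph_def image_iff)
  then have "finite ?M"
    by (rule finite_subset) simp
  then show ?thesis
    unfolding Mad_def using assms by (intro Max_ge) auto
qed

theorem theorem16:
  fixes G :: "('a, 'b) pre_digraph"
  assumes "oriented_graph G"
    and "\<not> mixing 2 G"
  shows "Mad G \<ge> 7 / 2"
proof -
  interpret G: oriented_graph G
    by (rule assms(1))
  have "asym (arcs_ends G)"
    using G.no_opposite_arcs by (auto simp: asym_iff)
  moreover have "\<not> mix (arcs_ends G) (verts G)"
    using G.mixing_2I assms(2) by blast
  ultimately obtain B where B: "B \<subseteq> verts G" "B \<noteq> {}"
    and dense: "7 * card B \<le> 4 * card (arcs_in (arcs_ends G) B)"
    using dense_if_not_mix[OF G.finite_verts] by blast
  have "card B > 0"
    using B G.finite_verts by (meson card_gt_0_iff finite_subset)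
  moreover have "7 * real (card B) \<le> 4 * real (card (arcs (G \<restriction> B)))"
    using dense unfolding G.card_arcs_induce_subgraph by linarith
  ultimately have "7 / 2 \<le> 2 * real (card (arcs (G \<restriction> B))) / real (card (verts (G \<restriction> B)))"
    by (simp add: field_simps)
  also have "\<dots> \<le> Mad G"
    using B by (intro G.Mad_ge) (auto intro: G.subgraph_induce_subgraphI)
  finally show ?thesis .
qed

end
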